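(* Let $K$ be a field and let $L$ be a finite modular lattice. Let $I_L \subset K[L]$ be the ideal generated by all basic binomials $ab-(a\wedge b)(a\vee b)$, $a,b\in L$. Then the following conditions are equivalent: (i) $L$ is a planar distributive lattice; (ii) $I_L$ has a squarefree initial ideal with respect to the lexicographic order for any order of the variables; (iii) $I_L$ has a squarefree initial ideal with respect to any monomial order.
   Context: For a finite lattice $L$ and a field $K$, $K[L]$ denotes the polynomial ring over $K$ in $|L|$ variables, the variables being the elements of $L$. A binomial of the form $ab-(a\wedge b)(a\vee b)$ with $a,b\in L$ (a polynomial in $K[L]$, where products are products of variables) is called a basic binomial, and $I_L$ is the ideal of $K[L]$ generated by all basic binomials. A lattice $L$ is modular if $x\le b$ implies $x\vee(a\wedge b)=(x\vee a)\wedge b$ for all $x,a,b\in L$. Let $\mathbb{N}^2$ denote the infinite distributive lattice of all pairs $(i,j)$ of nonnegative integers with partial order $(i,j)\le(k,l)$ if and only if $i\le k$ and $j\le l$. A planar distributive lattice is (up to isomorphism of lattices) a finite sublattice $L$ of $\mathbb{N}^2$ with $(0,0)\in L$, a sublattice being a subset closed under the meet and join of $\mathbb{N}^2$. For a monomial order $<$ on $K[L]$, the initial ideal $\mathrm{in}_<(I_L)$ is squarefree if it is generated by squarefree monomials. In (ii), the condition is required for the lexicographic order induced by each total order of the variables; in (iii), it is required for each monomial order on $K[L]$. *)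

theory Defs
  imports HOL.Modules "HOL-Library.Poly_Mapping" "HOL-Library.Product_Order"
begin

text \<open>
  The polynomial ring \<open>K[L]\<close> is the type \<open>('a \<Rightarrow>\<^sub>0 nat) \<Rightarrow>\<^sub>0 'k\<close>: the lattice \<open>L\<close> is the type \<open>'a\<close>, the
  field \<open>K\<close> is the type \<open>'k\<close>, and a monomial is identified with its exponent vector in \<open>'a \<Rightarrow>\<^sub>0 nat\<close>
  (so products of monomials are sums of exponent vectors and the monomial 1 is \<open>0\<close>).
\<close>

type_synonym ('a, 'k) mpoly = "('a \<Rightarrow>\<^sub>0 nat) \<Rightarrow>\<^sub>0 'k"

definition monomial :: "('a \<Rightarrow>\<^sub>0 nat) \<Rightarrow> ('a, 'k::comm_ring_1) mpoly" where
  "monomial u = Poly_Mapping.single u 1"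

definition var :: "'a \<Rightarrow> ('a, 'k::comm_ring_1) mpoly" where
  "var a = monomial (Poly_Mapping.single a 1)"

text \<open>
  A commutative ring is a module over itself by multiplication; its submodules are the ideals, and
  \<open>ideal.span B\<close> is the ideal generated by \<open>B\<close>.
\<close>

interpretation ideal: module "(*) :: 'r::comm_ring_1 \<Rightarrow> 'r \<Rightarrow> 'r"
  by standard (simp_all add: algebra_simps)

definition basic_binomial :: "'a::lattice \<Rightarrow> 'a \<Rightarrow> ('a, 'k::field) mpoly" where
  "basic_binomial a b = var a * var b - var (inf a b) * var (sup a b)"

definition lattice_ideal :: "('a::lattice, 'k::field) mpoly set" where
  "lattice_ideal = ideal.span {basic_binomial a b | a b. True}"

definition strict_total_order :: "('b \<Rightarrow> 'b \<Rightarrow> bool) \<Rightarrow> bool" where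
  "strict_total_order lt \<longleftrightarrow> irreflp lt \<and> transp lt \<and> totalp lt"

definition monomial_order :: "(('a \<Rightarrow>\<^sub>0 nat) \<Rightarrow> ('a \<Rightarrow>\<^sub>0 nat) \<Rightarrow> bool) \<Rightarrow> bool" where
  "monomial_order lt \<longleftrightarrow> strict_total_order lt \<and>
     (\<forall>u. u \<noteq> 0 \<longrightarrow> lt 0 u) \<and>
     (\<forall>u v w. lt u v \<longrightarrow> lt (u + w) (v + w))"

text \<open>
  The (pure) lexicographic order induced by the order \<open>lt\<close> of the variables, where \<open>lt x y\<close> means
  that \<open>x\<close> is smaller than \<open>y\<close>: exponents are compared at the largest variable where they differ.
\<close>

definition lex_order :: "('a \<Rightarrow> 'a \<Rightarrow> bool) \<Rightarrow> ('a \<Rightarrow>\<^sub>0 nat) \<Rightarrow> ('a \<Rightarrow>\<^sub>0 nat) \<Rightarrow> bool" where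
  "lex_order lt u v \<longleftrightarrow>
     (\<exists>x. Poly_Mapping.lookup u x < Poly_Mapping.lookup v x \<and>
          (\<forall>y. lt x y \<longrightarrow> Poly_Mapping.lookup u y = Poly_Mapping.lookup v y))"

text \<open>Only meaningful when \<open>f \<noteq> 0\<close> and \<open>lt\<close> is a strict total order.\<close>

definition initial_monomial ::
    "(('a \<Rightarrow>\<^sub>0 nat) \<Rightarrow> ('a \<Rightarrow>\<^sub>0 nat) \<Rightarrow> bool) \<Rightarrow> ('a, 'k::comm_ring_1) mpoly \<Rightarrow> ('a \<Rightarrow>\<^sub>0 nat)" where
  "initial_monomial lt f =
     (THE u. u \<in> Poly_Mapping.keys f \<and> (\<forall>v \<in> Poly_Mapping.keys f. v \<noteq> u \<longrightarrow> lt v u))"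

definition initial_ideal ::
    "(('a \<Rightarrow>\<^sub>0 nat) \<Rightarrow> ('a \<Rightarrow>\<^sub>0 nat) \<Rightarrow> bool) \<Rightarrow> ('a, 'k::comm_ring_1) mpoly set \<Rightarrow> ('a, 'k) mpoly set" where
  "initial_ideal lt I = ideal.span {monomial (initial_monomial lt f) | f. f \<in> I \<and> f \<noteq> 0}"

definition squarefree_monomial_ideal :: "('a, 'k::comm_ring_1) mpoly set \<Rightarrow> bool" where
  "squarefree_monomial_ideal J \<longleftrightarrow>
     (\<exists>M. (\<forall>u \<in> M. \<forall>x. Poly_Mapping.lookup u x \<le> 1) \<and> J = ideal.span (monomial ` M))"

text \<open>
  The lattice \<open>\<nat>\<^sup>2\<close> is \<open>nat \<times> nat\<close> with the componentwise order.
\<close>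

definition sublattice :: "'b::lattice set \<Rightarrow> bool" where
  "sublattice S \<longleftrightarrow> (\<forall>x \<in> S. \<forall>y \<in> S. inf x y \<in> S \<and> sup x y \<in> S)"

definition planar_distributive :: "'a::lattice itself \<Rightarrow> bool" where
  "planar_distributive _ \<longleftrightarrow>
     (\<exists>(S :: (nat \<times> nat) set) (f :: 'a \<Rightarrow> nat \<times> nat).
        finite S \<and> sublattice S \<and> (0, 0) \<in> S \<and>
        bij_betw f UNIV S \<and>
        (\<forall>x y. f (inf x y) = inf (f x) (f y) \<and> f (sup x y) = sup (f x) (f y)))"

definition modular_lattice :: "'a::lattice itself \<Rightarrow> bool" where
  "modular_lattice _ \<longleftrightarrow>
     (\<forall>x a b :: 'a. x \<le> b \<longrightarrow> sup x (inf a b) = inf (sup x a) b)"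

end

theory Submission imports Defs begin

text \<open>
  Write \<open>u \<sim> v\<close> for monomials whose difference lies in \<open>I = lattice_ideal\<close>.  As \<open>I\<close> is generated by
  differences of two monomials, a polynomial of \<open>I\<close> has coefficient sum zero over every class of
  \<open>\<sim>\<close>, so that a monomial belongs to the initial ideal exactly when it is not the least element of
  its class.  Both directions of the equivalence become statements about classes of monomials.
  To bound classes from outside it is enough to know some functions of monomials that do not change
  under the rewriting \<open>ab \<rightarrow> (a \<and> b)(a \<or> b)\<close>; \<open>fibre_sum_lattice_ideal\<close> is the vanishing of
  coefficient sums in this form.

  Planar implies squarefree.  For a sublattice of \<open>\<nat>\<^sup>2\<close>, regard \<open>(i, j)\<close> as an edge between the row
  \<open>i\<close> and the column \<open>j\<close> of a bipartite graph.  Rewriting preserves the degree of every row and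
  column, and conversely two monomials with equal row and column degrees are congruent: from both the
  join of the support can be split off, and one inducts on the degree
  (\<open>congruent_if_fibre_degrees_eq\<close>).  If \<open>u > v\<close> have equal row and column degrees, one peels
  alternating cycles off the pair \<open>(u, v)\<close>.  Each cycle gives squarefree monomials \<open>u\<^sub>1\<close> dividing \<open>u\<close>
  and \<open>v\<^sub>1\<close> dividing \<open>v\<close> with equal degrees, and \<open>u\<^sub>1 > v\<^sub>1\<close> must hold for one of them
  (\<open>squarefree_leading_divisor\<close>).  So every initial monomial has a squarefree divisor that is again
  initial, whatever the monomial order is.

  A lexicographic order is a monomial order, so the condition for all monomial orders implies the one
  for all lexicographic orders.

  Squarefree implies planar.  If the initial ideal is squarefree and \<open>u\<close> is not least in its class,
  then the radical of \<open>u\<close> is not least in its own class either (\<open>radical_not_least_in_class\<close>).  Two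
  configurations contradict this for a suitable order of the variables.
  \<^item> Let \<open>b \<noteq> c\<close> have the same meet \<open>o\<close> and the same join \<open>t\<close> with an element \<open>a\<close> of the modular
    lattice.  Then \<open>b\<^sup>2 o t \<sim> o t (b \<and> c)(b \<or> c)\<close>, whereas \<open>b o t\<close> is least in its class if \<open>b\<close> is
    made larger than \<open>o, t, b \<and> c, b \<or> c\<close> and smaller than all other variables.
  \<^item> Let \<open>x, y, z\<close> be elements of a distributive lattice with pairwise join \<open>t\<close>, such that no pairwise
    meet equals \<open>o = x \<and> y \<and> z\<close>.  Then \<open>t\<^sup>2 o \<sim> x y z\<close>, whereas \<open>t o\<close> is least in its class if
    \<open>t\<close> is made larger than \<open>o, x, y, z\<close> and smaller than all other variables.

  A modular lattice without the first configuration is distributive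
  (\<open>modular_cancellative_imp_distributive\<close>).  In a distributive lattice without the second one the
  join-primes contain no antichain of three elements, hence are covered by two chains
  (\<open>width_two_imp_two_chains\<close>, the theorem of Dilworth for width two); counting the join-primes of
  each chain below an element embeds the lattice into \<open>\<nat>\<^sup>2\<close>.
\<close>

abbreviation lookup where "lookup \<equiv> Poly_Mapping.lookup"
abbreviation keys where "keys \<equiv> Poly_Mapping.keys"

section \<open>Initial monomials and monomial ideals\<close>

lemma strict_total_order_Max_exists:
  assumes "strict_total_order lt" "finite A" "A \<noteq> {}"
  shows "\<exists>m\<in>A. \<forall>x\<in>A. x \<noteq> m \<longrightarrow> lt x m"
  using assms(2,3)
proof (induction A rule: finite_ne_induct)
  case (insert x F)
  then obtain m where m: "m \<in> F" "\<forall>y\<in>F. y \<noteq> m \<longrightarrow> lt y m"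
    by blast
  have "lt x m \<or> lt m x"
    using assms(1) m(1) insert.hyps(3) unfolding strict_total_order_def totalp_on_def
    by (metis UNIV_I)
  then show ?case
  proof
    assume "lt m x"
    moreover have "lt y x" if "lt y m" for y
      using assms(1) that \<open>lt m x\<close> unfolding strict_total_order_def by (auto dest: transpD)
    ultimately have "\<forall>y\<in>insert x F. y \<noteq> x \<longrightarrow> lt y x"
      using m(2) by auto
    then show ?thesis
      by blast
  next
    assume "lt x m"
    then show ?thesis
      using m by auto
  qed
qed simp

lemma strict_total_order_asym:
  assumes "strict_total_order lt" "lt x y" shows "\<not> lt y x"
  using assms unfolding strict_total_order_def by (metis irreflpD transpD)

lemma initial_monomialI:
  assumes "strict_total_order lt" "u \<in> keys f" "\<And>v. v \<in> keys f \<Longrightarrow> v \<noteq> u \<Longrightarrow> lt v u"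
  shows "initial_monomial lt f = u"
  unfolding initial_monomial_def
proof (rule the_equality)
  show "u \<in> keys f \<and> (\<forall>v\<in>keys f. v \<noteq> u \<longrightarrow> lt v u)"
    using assms(2,3) by (intro conjI ballI impI)
next
  fix w assume w: "w \<in> keys f \<and> (\<forall>v\<in>keys f. v \<noteq> w \<longrightarrow> lt v w)"
  show "w = u"
  proof (rule ccontr)
    assume "w \<noteq> u"
    then have "lt u w" "lt w u"
      using w assms(2) assms(3)[of w] by auto
    then show False
      using strict_total_order_asym[OF assms(1)] by blast
  qed
qed

lemma initial_monomial_greatest:
  assumes "strict_total_order lt" "f \<noteq> 0"
  shows "initial_monomial lt f \<in> keys f"
    and "\<And>v. v \<in> keys f \<Longrightarrow> v \<noteq> initial_monomial lt f \<Longrightarrow> lt v (initial_monomial lt f)"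
proof -
  have "keys f \<noteq> {}"
    using assms(2) by simp
  then obtain m where m: "m \<in> keys f" "\<forall>x\<in>keys f. x \<noteq> m \<longrightarrow> lt x m"
    using strict_total_order_Max_exists[OF assms(1) finite_keys] by blast
  then have "initial_monomial lt f = m"
    using initial_monomialI[OF assms(1)] by blast
  then show "initial_monomial lt f \<in> keys f"
    and "\<And>v. v \<in> keys f \<Longrightarrow> v \<noteq> initial_monomial lt f \<Longrightarrow> lt v (initial_monomial lt f)"
    using m by auto
qed

lemma monomial_add: "monomial (u + v) = (monomial u * monomial v :: ('a, 'k::comm_ring_1) mpoly)"
  by (simp add: monomial_def mult_single)

lemma keys_monomial: "keys (monomial u :: ('a, 'k::comm_ring_1) mpoly) = {u}"
  by (simp add: monomial_def)

text \<open>
  The polynomials all of whose terms are divisible by some monomial of \<open>M\<close> form an ideal, which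
  contains \<open>M\<close>.
\<close>

lemma in_span_monomials_dest:
  fixes p :: "('a, 'k::comm_ring_1) mpoly"
  assumes "p \<in> ideal.span (monomial ` M)" "m \<in> keys p"
  shows "\<exists>u\<in>M. \<exists>w. m = u + w"
  using assms
proof (induction arbitrary: m rule: ideal.span_induct_alt)
  case (step c x y)
  then obtain u where u: "u \<in> M" "x = monomial u"
    by blast
  have "keys (c * x + y) \<subseteq> keys (c * x) \<union> keys y"
    by (rule keys_add)
  moreover have "keys (c * x) \<subseteq> {a + b | a b. a \<in> keys c \<and> b \<in> keys x}"
    by (rule keys_mult)
  ultimately have "m \<in> keys y \<or> (\<exists>a. m = a + u)"
    using step.prems u(2) keys_monomial[of u, where 'k='k] by fastforce
  then show ?case
    using step.IH u(1) by (metis add.commute)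
qed simp

lemma monomial_in_span_monomials:
  "(monomial m :: ('a, 'k::comm_ring_1) mpoly) \<in> ideal.span (monomial ` M) \<Longrightarrow> \<exists>u\<in>M. \<exists>w. m = u + w"
  using in_span_monomials_dest[of "monomial m" M m] by (simp add: keys_monomial)

lemma lex_order_monomial_order:
  fixes lt :: "'a::finite \<Rightarrow> 'a \<Rightarrow> bool"
  assumes lt: "strict_total_order lt"
  shows "monomial_order (lex_order lt)"
proof -
  have total: "x = y \<or> lt x y \<or> lt y x" for x y
    using lt unfolding strict_total_order_def totalp_on_def by blast
  have trans: "lt x y \<Longrightarrow> lt y z \<Longrightarrow> lt x z" for x y z
    using lt unfolding strict_total_order_def by (blast dest: transpD)
  have "irreflp (lex_order lt)"
    by (rule irreflpI) (auto simp: lex_order_def)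
  moreover have "transp (lex_order lt)"
  proof (rule transpI)
    fix u v w assume "lex_order lt u v" "lex_order lt v w"
    then obtain x y where
      x: "lookup u x < lookup v x" "\<And>z. lt x z \<Longrightarrow> lookup u z = lookup v z" and
      y: "lookup v y < lookup w y" "\<And>z. lt y z \<Longrightarrow> lookup v z = lookup w z"
      unfolding lex_order_def by blast
    consider "lt x y" | "lt y x" | "x = y"
      using total by blast
    then show "lex_order lt u w"
    proof cases
      case 1
      then show ?thesis unfolding lex_order_def
        using x y trans by (intro exI[of _ y]) auto
    next
      case 2
      then show ?thesis unfolding lex_order_def
        using x y trans by (intro exI[of _ x]) auto
    next
      case 3
      then show ?thesis unfolding lex_order_def
        using x y by (intro exI[of _ x]) auto
    qed
  qed
  moreover have tot: "lex_order lt u v \<or> lex_order lt v u" if "u \<noteq> v" for u v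
  proof -
    have "{x. lookup u x \<noteq> lookup v x} \<noteq> {}"
      using that by (metis (mono_tags, lifting) empty_Collect_eq poly_mapping_eqI)
    then obtain m where m: "lookup u m \<noteq> lookup v m"
      "\<And>x. lookup u x \<noteq> lookup v x \<Longrightarrow> x \<noteq> m \<Longrightarrow> lt x m"
      using strict_total_order_Max_exists[OF lt, of "{x. lookup u x \<noteq> lookup v x}"] by auto
    then have "lookup u y = lookup v y" if "lt m y" for y
      using that strict_total_order_asym[OF lt] by metis
    then show ?thesis
      unfolding lex_order_def using m(1) by (metis linorder_neqE_nat)
  qed
  moreover have "lex_order lt 0 u" if "u \<noteq> 0" for u
  proof -
    have "\<not> lex_order lt u 0"
      by (auto simp: lex_order_def)
    then show ?thesis
      using tot that by blast
  qed
  moreover have "lex_order lt (u + w) (v + w)" if "lex_order lt u v" for u v w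
    using that by (auto simp: lex_order_def lookup_add)
  ultimately show ?thesis
    unfolding monomial_order_def strict_total_order_def by (auto intro: totalpI)
qed

section \<open>Monomials modulo the ideal of basic binomials\<close>

text \<open>
  The type argument only fixes the coefficient field, which the two monomials do not determine.
\<close>

definition monomials_congruent ::
  "('a::lattice, 'k::field) mpoly itself \<Rightarrow> ('a \<Rightarrow>\<^sub>0 nat) \<Rightarrow> ('a \<Rightarrow>\<^sub>0 nat) \<Rightarrow> bool" where
  "monomials_congruent _ u v \<longleftrightarrow> (monomial u - monomial v :: ('a, 'k) mpoly) \<in> lattice_ideal"

lemma congruent_refl: "monomials_congruent K u u"
  by (simp add: monomials_congruent_def lattice_ideal_def ideal.span_zero)

lemma congruent_sym: "monomials_congruent K u v \<Longrightarrow> monomials_congruent K v u"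
  unfolding monomials_congruent_def lattice_ideal_def by (drule ideal.span_neg) simp

lemma congruent_trans:
  "monomials_congruent K u v \<Longrightarrow> monomials_congruent K v w \<Longrightarrow> monomials_congruent K u w"
  unfolding monomials_congruent_def lattice_ideal_def by (drule (1) ideal.span_add) simp

lemma congruent_add_left: "monomials_congruent K u v \<Longrightarrow> monomials_congruent K (w + u) (w + v)"
  unfolding monomials_congruent_def lattice_ideal_def
  by (drule ideal.span_scale[where c = "monomial w"]) (simp add: monomial_add algebra_simps)

lemma congruent_add_right: "monomials_congruent K u v \<Longrightarrow> monomials_congruent K (u + w) (v + w)"
  using congruent_add_left[of K u v w] by (simp add: add.commute)

abbreviation exponent_of_var :: "'a \<Rightarrow> 'a \<Rightarrow>\<^sub>0 nat" ("\<epsilon>") where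
  "\<epsilon> a \<equiv> Poly_Mapping.single a 1"

lemma congruent_straighten: "monomials_congruent K (\<epsilon> a + \<epsilon> b) (\<epsilon> (inf a b) + \<epsilon> (sup a b))"
proof -
  have "basic_binomial a b \<in> (lattice_ideal :: ('a::lattice, 'k::field) mpoly set)"
    unfolding lattice_ideal_def by (rule ideal.span_base) blast
  then show ?thesis
    by (simp add: monomials_congruent_def basic_binomial_def var_def flip: monomial_add)
qed

text \<open>
  The factor \<open>w\<close> makes \<open>\<phi>\<close> constant on classes of monomials without any compatibility of \<open>\<phi>\<close> with
  multiplication, so that sets, bounds and the like qualify as values.
\<close>

definition straightening_invariant :: "(('a::lattice \<Rightarrow>\<^sub>0 nat) \<Rightarrow> 'c) \<Rightarrow> bool" where
  "straightening_invariant \<phi> \<longleftrightarrow>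
     (\<forall>a b w. \<phi> (\<epsilon> a + \<epsilon> b + w) = \<phi> (\<epsilon> (inf a b) + \<epsilon> (sup a b) + w))"

lemma straightening_invariant_translate:
  "straightening_invariant \<phi> \<Longrightarrow> straightening_invariant (\<lambda>u. \<phi> (u + w))"
  by (simp add: straightening_invariant_def add.assoc)

lemma straightening_invariant_Pair:
  "straightening_invariant \<phi> \<Longrightarrow> straightening_invariant \<psi> \<Longrightarrow> straightening_invariant (\<lambda>u. (\<phi> u, \<psi> u))"
  by (simp add: straightening_invariant_def)

definition fibre_sum ::
  "(('a \<Rightarrow>\<^sub>0 nat) \<Rightarrow> 'c) \<Rightarrow> 'c \<Rightarrow> ('a, 'k::comm_ring_1) mpoly \<Rightarrow> 'k" where
  "fibre_sum \<phi> c f = (\<Sum>u\<in>keys f. if \<phi> u = c then lookup f u else 0)"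

lemma fibre_sum_superset:
  assumes "finite F" "keys f \<subseteq> F"
  shows "fibre_sum \<phi> c f = (\<Sum>u\<in>F. if \<phi> u = c then lookup f u else 0)"
  unfolding fibre_sum_def using assms
  by (intro sum.mono_neutral_left) (auto simp: in_keys_iff)

lemma fibre_sum_add: "fibre_sum \<phi> c (f + g) = fibre_sum \<phi> c f + fibre_sum \<phi> c g"
proof -
  have F: "finite (keys f \<union> keys g)" "keys (f + g) \<subseteq> keys f \<union> keys g"
    by (simp_all add: keys_add)
  show ?thesis
    unfolding fibre_sum_superset[OF F] fibre_sum_superset[OF F(1) Un_upper1]
      fibre_sum_superset[OF F(1) Un_upper2] sum.distrib[symmetric]
    by (intro sum.cong) (auto simp: lookup_add)
qed

lemma fibre_sum_zero: "fibre_sum \<phi> c 0 = 0"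
  by (simp add: fibre_sum_def)

lemma fibre_sum_sum: "fibre_sum \<phi> c (\<Sum>i\<in>I. f i) = (\<Sum>i\<in>I. fibre_sum \<phi> c (f i))"
  by (induction I rule: infinite_finite_induct) (auto simp: fibre_sum_add fibre_sum_zero)

lemma fibre_sum_single: "fibre_sum \<phi> c (Poly_Mapping.single u a) = (if \<phi> u = c then a else 0)"
  by (simp add: fibre_sum_def)

lemma fibre_sum_diff: "fibre_sum \<phi> c (f - g) = fibre_sum \<phi> c f - fibre_sum \<phi> c g"
  using fibre_sum_add[of \<phi> c "f - g" g] by (simp add: algebra_simps)

lemma mpoly_as_sum_of_terms:
  fixes p :: "('a, 'k::comm_ring_1) mpoly"
  shows "p = (\<Sum>w\<in>keys p. Poly_Mapping.single w (lookup p w))"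
proof (rule poly_mapping_eqI)
  fix u
  have "lookup (\<Sum>w\<in>keys p. Poly_Mapping.single w (lookup p w)) u
      = (\<Sum>w\<in>keys p. if u = w then lookup p u else 0)"
    unfolding lookup_sum by (intro sum.cong) (auto simp: lookup_single when_def)
  also have "\<dots> = lookup p u"
    by (simp add: in_keys_iff)
  finally show "lookup p u = lookup (\<Sum>w\<in>keys p. Poly_Mapping.single w (lookup p w)) u" ..
qed

text \<open>
  A term times a basic binomial consists of two terms with opposite coefficients whose monomials have
  the same value under \<open>\<phi>\<close>; elements of the ideal are sums of such products.
\<close>

lemma fibre_sum_lattice_ideal:
  fixes f :: "('a::lattice, 'k::field) mpoly"
  assumes inv: "straightening_invariant \<phi>" and f: "f \<in> lattice_ideal"
  shows "fibre_sum \<phi> c f = 0"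
  using f unfolding lattice_ideal_def
proof (induction rule: ideal.span_induct_alt)
  case base
  then show ?case by (simp add: fibre_sum_zero)
next
  case (step p x y)
  then obtain a b where x: "x = basic_binomial a b"
    by blast
  have "fibre_sum \<phi> c (Poly_Mapping.single w t * x) = 0" for w t
  proof -
    have "Poly_Mapping.single w t * x = Poly_Mapping.single (\<epsilon> a + \<epsilon> b + w) t
        - Poly_Mapping.single (\<epsilon> (inf a b) + \<epsilon> (sup a b) + w) t"
      by (simp add: x basic_binomial_def var_def monomial_def mult_single algebra_simps)
    then show ?thesis
      using inv by (simp add: fibre_sum_diff fibre_sum_single straightening_invariant_def)
  qed
  then have "fibre_sum \<phi> c (p * x) = 0"
    by (subst mpoly_as_sum_of_terms[of p]) (simp add: sum_distrib_right fibre_sum_sum)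
  then show ?case
    by (simp add: fibre_sum_add step.IH)
qed

text \<open>
  If \<open>u\<close> were the only monomial of \<open>f\<close> with its value under \<open>\<phi>\<close>, the coefficient sum over that value
  would be the coefficient of \<open>u\<close>, which is not zero.
\<close>

lemma invariant_companion_of_key:
  fixes f :: "('a::lattice, 'k::field) mpoly"
  assumes "straightening_invariant \<phi>" "f \<in> lattice_ideal" "u \<in> keys f"
  shows "\<exists>v\<in>keys f. v \<noteq> u \<and> \<phi> v = \<phi> u"
proof (rule ccontr)
  assume "\<not> ?thesis"
  then have "fibre_sum \<phi> (\<phi> u) f = (\<Sum>v\<in>keys f. if v = u then lookup f u else 0)"
    unfolding fibre_sum_def by (intro sum.cong) auto
  also have "\<dots> = lookup f u"
    using assms(3) by simp
  finally show False
    using fibre_sum_lattice_ideal[OF assms(1,2)] assms(3) by (simp add: in_keys_iff)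
qed

lemma congruent_invariant:
  assumes "straightening_invariant \<phi>" "monomials_congruent (K :: ('a::lattice, 'k::field) mpoly itself) u v"
  shows "\<phi> u = \<phi> v"
proof -
  have "fibre_sum \<phi> (\<phi> u) (monomial u - monomial v :: ('a, 'k) mpoly) = 0"
    using assms(2) unfolding monomials_congruent_def by (rule fibre_sum_lattice_ideal[OF assms(1)])
  then show ?thesis
    by (auto simp: fibre_sum_diff monomial_def fibre_sum_single split: if_splits)
qed

text \<open>
  The binomial \<open>u - v\<close> itself is the element of the ideal with initial monomial \<open>u\<close>.
\<close>

lemma congruent_initial:
  assumes "strict_total_order lt" "monomials_congruent (K :: ('a::lattice, 'k::field) mpoly itself) u v" "lt v u"
  shows "(monomial u :: ('a, 'k) mpoly) \<in> initial_ideal lt lattice_ideal"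
proof -
  have "u \<noteq> v"
    using assms(1,3) by (metis strict_total_order_asym)
  define f :: "('a, 'k) mpoly" where "f = monomial u - monomial v"
  have lk: "lookup f w = (if w = u then 1 else if w = v then -1 else 0)" for w
    using \<open>u \<noteq> v\<close> by (auto simp: f_def monomial_def lookup_minus lookup_single when_def)
  have k: "keys f = {u, v}"
    using lk by (auto simp: in_keys_iff split: if_splits)
  then have "f \<noteq> 0" by auto
  moreover have "initial_monomial lt f = u"
    using k assms(3) by (intro initial_monomialI[OF assms(1)]) auto
  moreover have "f \<in> lattice_ideal"
    using assms(2) by (simp add: f_def monomials_congruent_def)
  ultimately show ?thesis
    unfolding initial_ideal_def by (intro ideal.span_base) blast
qed

definition radical_monomial :: "('a::finite \<Rightarrow>\<^sub>0 nat) \<Rightarrow> 'a \<Rightarrow>\<^sub>0 nat" where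
  "radical_monomial u = (\<Sum>x\<in>keys u. \<epsilon> x)"

lemma lookup_radical_monomial: "lookup (radical_monomial u) x = (if x \<in> keys u then 1 else 0)"
proof -
  have "lookup (radical_monomial u) x = (\<Sum>y\<in>keys u. if x = y then 1 else 0)"
    unfolding radical_monomial_def lookup_sum
    by (intro sum.cong) (auto simp: lookup_single when_def)
  then show ?thesis by simp
qed

lemma exponent_add_diff:
  fixes u v :: "'a \<Rightarrow>\<^sub>0 nat"
  assumes "\<And>x. lookup u x \<le> lookup v x"
  shows "v = u + (v - u)"
  using assms by (intro poly_mapping_eqI) (simp add: lookup_add lookup_minus)

text \<open>
  A squarefree generator dividing \<open>u\<close> divides the radical of \<open>u\<close>, so the radical is a multiple of the
  initial monomial of some \<open>f\<close> in the ideal.  Another monomial of \<open>f\<close> with the same value under the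
  translated invariant is smaller, and the same multiple of it is the required \<open>v'\<close>.
\<close>

lemma radical_not_least_in_class:
  fixes u v :: "'a::{finite,lattice} \<Rightarrow>\<^sub>0 nat"
  assumes lt: "monomial_order lt"
    and sq: "squarefree_monomial_ideal (initial_ideal lt (lattice_ideal :: ('a, 'k::field) mpoly set))"
    and uv: "monomials_congruent TYPE(('a, 'k) mpoly) u v" "lt v u"
    and inv: "straightening_invariant \<phi>"
  shows "\<exists>v'. lt v' (radical_monomial u) \<and> \<phi> v' = \<phi> (radical_monomial u)"
proof -
  have sto: "strict_total_order lt"
    using lt by (simp add: monomial_order_def)
  obtain M where M: "\<And>u x. u \<in> M \<Longrightarrow> lookup u x \<le> 1"
    "initial_ideal lt (lattice_ideal :: ('a, 'k) mpoly set) = ideal.span (monomial ` M)"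
    using sq unfolding squarefree_monomial_ideal_def by blast
  obtain m w where m: "m \<in> M" "u = m + w"
    using monomial_in_span_monomials[OF congruent_initial[OF sto uv, unfolded M(2)]] by blast
  have "lookup m x \<le> lookup (radical_monomial u) x" for x
    using M(1)[OF m(1), of x] by (auto simp: lookup_radical_monomial m(2) in_keys_iff lookup_add)
  then obtain w1 where w1: "radical_monomial u = m + w1"
    using exponent_add_diff[of m "radical_monomial u"] by blast
  have "(monomial m :: ('a, 'k) mpoly) \<in> initial_ideal lt lattice_ideal"
    unfolding M(2) using m(1) by (intro ideal.span_base) blast
  moreover have "initial_ideal lt (lattice_ideal :: ('a, 'k) mpoly set)
      = ideal.span (monomial ` (initial_monomial lt ` {f \<in> lattice_ideal :: ('a, 'k) mpoly set. f \<noteq> 0}))"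
    unfolding initial_ideal_def by (rule arg_cong[where f = ideal.span]) blast
  ultimately have "(monomial m :: ('a, 'k) mpoly) \<in>
      ideal.span (monomial ` (initial_monomial lt ` {f \<in> lattice_ideal :: ('a, 'k) mpoly set. f \<noteq> 0}))"
    by (simp only:)
  then obtain f :: "('a, 'k) mpoly" and w2
    where f: "f \<in> lattice_ideal" "f \<noteq> 0" "m = initial_monomial lt f + w2"
    by (blast dest: monomial_in_span_monomials)
  let ?w = "w2 + w1"
  obtain v' where v': "v' \<in> keys f" "v' \<noteq> initial_monomial lt f"
    "\<phi> (v' + ?w) = \<phi> (initial_monomial lt f + ?w)"
    using invariant_companion_of_key[OF straightening_invariant_translate[OF inv] f(1)
        initial_monomial_greatest(1)[OF sto f(2)]] by blast
  have "lt (v' + ?w) (initial_monomial lt f + ?w)"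
    using lt initial_monomial_greatest(2)[OF sto f(2) v'(1,2)] unfolding monomial_order_def by blast
  moreover have "radical_monomial u = initial_monomial lt f + ?w"
    by (simp add: w1 f(3) add.assoc)
  ultimately show ?thesis
    using v'(3) by metis
qed

section \<open>Weights of monomials\<close>

definition weight :: "('a::finite \<Rightarrow> nat) \<Rightarrow> ('a \<Rightarrow>\<^sub>0 nat) \<Rightarrow> nat" where
  "weight h u = (\<Sum>x\<in>UNIV. h x * lookup u x)"

lemma weight_zero [simp]: "weight h 0 = 0"
  by (simp add: weight_def)

lemma weight_add [simp]: "weight h (u + v) = weight h u + weight h v"
  by (simp add: weight_def lookup_add algebra_simps sum.distrib)

lemma weight_single [simp]: "weight h (Poly_Mapping.single a n) = h a * n"
proof -
  have "weight h (Poly_Mapping.single a n) = (\<Sum>x\<in>UNIV. if x = a then h a * n else 0)"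
    unfolding weight_def by (intro sum.cong) (auto simp: lookup_single when_def)
  then show ?thesis by simp
qed

lemma weight_sum: "weight h (\<Sum>i\<in>I. u i) = (\<Sum>i\<in>I. weight h (u i))"
  by (induction I rule: infinite_finite_induct) auto

lemma weight_eq_0_iff: "weight h u = 0 \<longleftrightarrow> (\<forall>x\<in>keys u. h x = 0)"
  by (auto simp: weight_def in_keys_iff)

lemma straightening_invariant_weight:
  assumes "\<And>a b. h a + h b = h (inf a b) + h (sup a b)"
  shows "straightening_invariant (weight h)"
  using assms by (simp add: straightening_invariant_def)

abbreviation total_degree :: "('a::finite \<Rightarrow>\<^sub>0 nat) \<Rightarrow> nat" where
  "total_degree \<equiv> weight (\<lambda>_. 1)"

lemma total_degree_eq_0_iff: "total_degree u = 0 \<longleftrightarrow> u = 0"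
  by (auto simp: weight_def intro: poly_mapping_eqI)

lemma split_off_key:
  fixes u :: "'a \<Rightarrow>\<^sub>0 nat"
  assumes "x \<in> keys u"
  obtains w where "u = \<epsilon> x + w"
proof -
  have "u = \<epsilon> x + (u - \<epsilon> x)"
    using assms by (intro exponent_add_diff) (auto simp: lookup_single when_def in_keys_iff)
  then show ?thesis by (rule that)
qed

lemma split_off_two_keys:
  fixes u :: "'a \<Rightarrow>\<^sub>0 nat"
  assumes "x \<in> keys u" "y \<in> keys u" "x \<noteq> y"
  obtains w where "u = \<epsilon> x + \<epsilon> y + w"
proof -
  obtain w where w: "u = \<epsilon> x + w"
    using assms(1) by (rule split_off_key)
  then have "y \<in> keys w"
    using assms(2,3) by (simp add: in_keys_iff lookup_add lookup_single when_def)
  then obtain w' where "w = \<epsilon> y + w'"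
    by (rule split_off_key)
  then show ?thesis
    using that w by (simp add: add.assoc)
qed

lemma total_degree_Suc:
  assumes "total_degree u = Suc n"
  obtains x w where "u = \<epsilon> x + w" "total_degree w = n"
proof -
  have "keys u \<noteq> {}"
    using assms by auto
  then obtain x w where "u = \<epsilon> x + w"
    by (meson all_not_in_conv split_off_key)
  then show ?thesis
    using that assms by simp
qed

section \<open>Planar distributive lattices: all initial ideals are squarefree\<close>

text \<open>
  With \<open>r\<close> and \<open>c\<close> the two coordinates of \<open>\<nat>\<^sup>2\<close>, these are the degrees of the rows and of the columns
  in the bipartite multigraph with edge multiset \<open>u\<close>.
\<close>

definition fibre_degrees :: "('a::finite \<Rightarrow> 'i) \<Rightarrow> ('a \<Rightarrow>\<^sub>0 nat) \<Rightarrow> 'i \<Rightarrow> nat" where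
  "fibre_degrees r u i = weight (\<lambda>x. of_bool (r x = i)) u"

lemma fibre_degrees_add: "fibre_degrees r (u + v) i = fibre_degrees r u i + fibre_degrees r v i"
  by (simp add: fibre_degrees_def)

lemma fibre_degrees_pos_iff: "fibre_degrees r u i > 0 \<longleftrightarrow> i \<in> r ` keys u"
proof -
  have "fibre_degrees r u i = 0 \<longleftrightarrow> i \<notin> r ` keys u"
    unfolding fibre_degrees_def weight_eq_0_iff by auto
  then show ?thesis by auto
qed

lemma fibre_degrees_eq_imp_image_keys_eq:
  assumes "fibre_degrees r u = fibre_degrees r v"
  shows "r ` keys u = r ` keys v"
proof (rule set_eqI)
  fix i
  show "i \<in> r ` keys u \<longleftrightarrow> i \<in> r ` keys v"
    using assms by (simp flip: fibre_degrees_pos_iff)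
qed

lemma fibre_degrees_sum_vars:
  "fibre_degrees r (\<Sum>i\<in>A. \<epsilon> (s i)) j = (\<Sum>i\<in>A. of_bool (r (s i) = j))"
  by (simp add: fibre_degrees_def weight_sum)

lemma lookup_sum_vars_inj:
  assumes "finite A" "inj_on s A"
  shows "lookup (\<Sum>i\<in>A. \<epsilon> (s i)) x = of_bool (x \<in> s ` A)"
proof -
  have "lookup (\<Sum>i\<in>A. \<epsilon> (s i)) x = (\<Sum>i\<in>A. of_bool (x = s i))"
    unfolding lookup_sum by (intro sum.cong) (auto simp: lookup_single when_def)
  also have "\<dots> = (\<Sum>y\<in>s ` A. of_bool (x = y))"
    by (simp add: sum.reindex[OF assms(2)] o_def)
  also have "\<dots> = of_bool (x \<in> s ` A)"
    using assms(1) by (simp add: of_bool_def)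
  finally show ?thesis .
qed

text \<open>
  The cycles of a self-map of a finite set: images \<open>R \<supseteq> g ` R \<supseteq> g ` g ` R \<dots>\<close> become stationary.
\<close>

lemma finite_self_map_invariant_subset:
  assumes "finite R" "R \<noteq> {}" "g ` R \<subseteq> R"
  obtains A where "A \<subseteq> R" "A \<noteq> {}" "g ` A = A"
proof -
  have "\<exists>A\<subseteq>R. A \<noteq> {} \<and> g ` A = A"
    using assms
  proof (induction R rule: finite_psubset_induct)
    case (psubset R)
    show ?case
    proof (cases "g ` R = R")
      case False
      then have "\<exists>A\<subseteq>g ` R. A \<noteq> {} \<and> g ` A = A"
        using psubset.prems by (intro psubset.IH) auto
      then show ?thesis
        using psubset.prems(2) by (meson subset_trans)
    qed (use psubset.prems in blast)
  qed
  then show ?thesis using that by blast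
qed

text \<open>
  This finds a union of alternating cycles.  From a row \<open>i\<close> that \<open>u\<close> meets, follow an edge \<open>s i\<close> of
  \<open>u\<close> to a column and leave that column by an edge \<open>t i\<close> of \<open>v\<close>, which exists because \<open>u\<close> and \<open>v\<close>
  have the same column degrees.  This is a self-map of the finite set of rows met by \<open>u\<close>, and it
  permutes some nonempty set \<open>A\<close> of rows.  The edges \<open>s i\<close> and \<open>t i\<close> with \<open>i\<close> in \<open>A\<close> have the same
  column degrees by construction, and the same row degrees because \<open>A\<close> is permuted; as they leave
  respectively enter each row only once, no edge is repeated.
\<close>

lemma squarefree_circuit:
  fixes u v :: "'a::finite \<Rightarrow>\<^sub>0 nat"
  assumes "u \<noteq> 0" and row: "fibre_degrees r u = fibre_degrees r v"
    and col: "fibre_degrees c u = fibre_degrees c v"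
  obtains u1 v1 where "u1 \<noteq> 0" "\<And>x. lookup u1 x \<le> 1"
    "\<And>x. lookup u1 x \<le> lookup u x" "\<And>x. lookup v1 x \<le> lookup v x"
    "fibre_degrees r u1 = fibre_degrees r v1" "fibre_degrees c u1 = fibre_degrees c v1"
proof -
  define R where "R = r ` keys u"
  have "keys u \<noteq> {}"
    using \<open>u \<noteq> 0\<close> by simp
  then have R: "finite R" "R \<noteq> {}"
    by (auto simp: R_def)
  have "\<forall>i\<in>R. \<exists>x. x \<in> keys u \<and> r x = i"
    by (auto simp: R_def)
  then obtain s where s: "\<And>i. i \<in> R \<Longrightarrow> s i \<in> keys u" "\<And>i. i \<in> R \<Longrightarrow> r (s i) = i"
    by metis
  have "\<forall>i\<in>R. \<exists>y. y \<in> keys v \<and> c y = c (s i)"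
    using fibre_degrees_eq_imp_image_keys_eq[OF col] s(1) by (metis imageE imageI)
  then obtain t where t: "\<And>i. i \<in> R \<Longrightarrow> t i \<in> keys v" "\<And>i. i \<in> R \<Longrightarrow> c (t i) = c (s i)"
    by metis
  have "(\<lambda>i. r (t i)) ` R \<subseteq> R"
    using fibre_degrees_eq_imp_image_keys_eq[OF row] t(1) by (auto simp: R_def)
  then obtain A where A: "A \<subseteq> R" "A \<noteq> {}" "(\<lambda>i. r (t i)) ` A = A"
    using finite_self_map_invariant_subset[OF R] by metis
  have fin: "finite A"
    using A(1) R(1) by (rule finite_subset)
  \<comment> \<open>A surjection of a finite set onto itself is injective.\<close>
  have inj_rt: "inj_on (\<lambda>i. r (t i)) A"
    using fin A(3) by (simp add: eq_card_imp_inj_on)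
  have inj_s: "inj_on s A"
    using s(2) A(1) by (metis inj_onI subsetD)
  have inj_t: "inj_on t A"
    using inj_rt by (auto simp: inj_on_def)
  let ?u1 = "\<Sum>i\<in>A. \<epsilon> (s i)" and ?v1 = "\<Sum>i\<in>A. \<epsilon> (t i)"
  note lu = lookup_sum_vars_inj[OF fin inj_s] and lv = lookup_sum_vars_inj[OF fin inj_t]
  show ?thesis
  proof (rule that)
    obtain i where "i \<in> A" using A(2) by blast
    then have "lookup ?u1 (s i) = 1"
      unfolding lu by simp
    then show "?u1 \<noteq> 0"
      by (metis lookup_zero zero_neq_one)
    show "lookup ?u1 x \<le> 1" for x
      unfolding lu by simp
    show "lookup ?u1 x \<le> lookup u x" for x
      unfolding lu using s(1) A(1) by (auto simp: of_bool_def in_keys_iff Suc_le_eq)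
    show "lookup ?v1 x \<le> lookup v x" for x
      unfolding lv using t(1) A(1) by (auto simp: of_bool_def in_keys_iff Suc_le_eq)
    show "fibre_degrees r ?u1 = fibre_degrees r ?v1"
    proof
      fix j
      have "fibre_degrees r ?u1 j = (\<Sum>i\<in>A. of_bool (i = j))"
        unfolding fibre_degrees_sum_vars using s(2) A(1) by (intro sum.cong) auto
      also have "\<dots> = (\<Sum>i\<in>(\<lambda>i. r (t i)) ` A. of_bool (i = j))"
        by (simp only: A(3))
      also have "\<dots> = fibre_degrees r ?v1 j"
        unfolding fibre_degrees_sum_vars by (subst sum.reindex[OF inj_rt]) (simp add: o_def)
      finally show "fibre_degrees r ?u1 j = fibre_degrees r ?v1 j" .
    qed
    show "fibre_degrees c ?u1 = fibre_degrees c ?v1"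
    proof
      fix j
      show "fibre_degrees c ?u1 j = fibre_degrees c ?v1 j"
        unfolding fibre_degrees_sum_vars using t(2) A(1) by (intro sum.cong) auto
    qed
  qed
qed

text \<open>
  Split a circuit \<open>(u\<^sub>1, v\<^sub>1)\<close> off \<open>(u, v)\<close>.  Either \<open>v\<^sub>1 < u\<^sub>1\<close>, or the remaining pair still
  satisfies \<open>v\<^sub>2 < u\<^sub>2\<close>, since otherwise multiplying two inequalities would give \<open>u \<le> v\<close>; then
  induct on the degree.
\<close>

lemma squarefree_leading_divisor:
  fixes u v :: "'a::finite \<Rightarrow>\<^sub>0 nat"
  assumes lt: "monomial_order lt"
    and "fibre_degrees r u = fibre_degrees r v" "fibre_degrees c u = fibre_degrees c v" "lt v u"
  shows "\<exists>u1 v1 w. u = u1 + w \<and> (\<forall>x. lookup u1 x \<le> 1) \<and> lt v1 u1 \<and>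
    fibre_degrees r u1 = fibre_degrees r v1 \<and> fibre_degrees c u1 = fibre_degrees c v1"
  using assms(2-)
proof (induction "total_degree u" arbitrary: u v rule: less_induct)
  case (less u v)
  have sto: "strict_total_order lt" and mono: "\<And>u v w. lt u v \<Longrightarrow> lt (u + w) (v + w)"
    using lt by (auto simp: monomial_order_def)
  have trans: "\<And>x y z. lt x y \<Longrightarrow> lt y z \<Longrightarrow> lt x z" and total: "\<And>x y. x = y \<or> lt x y \<or> lt y x"
    using sto unfolding strict_total_order_def totalp_on_def by (blast dest: transpD)+
  have "u \<noteq> 0"
  proof
    assume "u = 0"
    then have "v = 0 \<or> lt u v"
      using lt by (auto simp: monomial_order_def)
    then show False
      using strict_total_order_asym[OF sto less.prems(3)] less.prems(3) \<open>u = 0\<close> by blast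
  qed
  then obtain u1 v1 where uv1: "u1 \<noteq> 0" "\<And>x. lookup u1 x \<le> 1"
    "\<And>x. lookup u1 x \<le> lookup u x" "\<And>x. lookup v1 x \<le> lookup v x"
    "fibre_degrees r u1 = fibre_degrees r v1" "fibre_degrees c u1 = fibre_degrees c v1"
    using squarefree_circuit[OF _ less.prems(1,2)] by metis
  define u2 v2 where "u2 = u - u1" and "v2 = v - v1"
  have u2: "u = u1 + u2" and v2: "v = v1 + v2"
    unfolding u2_def v2_def by (rule exponent_add_diff, rule uv1)+
  show ?case
  proof (cases "lt v1 u1")
    case True
    then show ?thesis
      using u2 uv1 by blast
  next
    case False
    have "lt v2 u2"
    proof (rule ccontr)
      assume "\<not> lt v2 u2"
      then have "u2 = v2 \<or> lt u2 v2" "u1 = v1 \<or> lt u1 v1"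
        using False total by blast+
      then have "u1 + u2 = v1 + u2 \<or> lt (u1 + u2) (v1 + u2)"
        "v1 + u2 = v1 + v2 \<or> lt (v1 + u2) (v1 + v2)"
        using mono[of u1 v1 u2] mono[of u2 v2 v1] by (auto simp: add.commute)
      then have "u1 + u2 = v1 + v2 \<or> lt (u1 + u2) (v1 + v2)"
        using trans[of "u1 + u2" "v1 + u2" "v1 + v2"] by auto
      then have "u = v \<or> lt u v"
        using u2 v2 by simp
      then show False
        using strict_total_order_asym[OF sto less.prems(3)] less.prems(3) by auto
    qed
    moreover have "fibre_degrees r u2 = fibre_degrees r v2" "fibre_degrees c u2 = fibre_degrees c v2"
      using less.prems(1,2) uv1(5,6) unfolding u2 v2 by (auto simp: fun_eq_iff fibre_degrees_add)
    moreover have "total_degree u2 < total_degree u"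
      using uv1(1) total_degree_eq_0_iff[of u1] unfolding u2 by simp
    ultimately obtain u3 v3 w where "u2 = u3 + w" "\<forall>x. lookup u3 x \<le> 1" "lt v3 u3"
      "fibre_degrees r u3 = fibre_degrees r v3" "fibre_degrees c u3 = fibre_degrees c v3"
      using less.hyps by blast
    then show ?thesis
      unfolding u2 by (metis add.left_commute)
  qed
qed

text \<open>
  In \<open>\<nat>\<^sup>2\<close> the join of the support is already the join of two elements of the support, one in the
  last row and one in the last column; a single rewriting step produces it as a factor.
\<close>

lemma extract_join_of_support:
  fixes u :: "'a::{finite,lattice} \<Rightarrow>\<^sub>0 nat" and f :: "'a \<Rightarrow> nat \<times> nat"
  assumes sup_f: "\<And>x y. f (sup x y) = sup (f x) (f y)" and "u \<noteq> 0"
  obtains t w where "monomials_congruent K u (\<epsilon> t + w)" "total_degree u = Suc (total_degree w)"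
    "f t = (Max ((fst \<circ> f) ` keys u), Max ((snd \<circ> f) ` keys u))"
proof -
  have "keys u \<noteq> {}"
    using \<open>u \<noteq> 0\<close> by simp
  then have im: "finite ((fst \<circ> f) ` keys u)" "(fst \<circ> f) ` keys u \<noteq> {}"
    "finite ((snd \<circ> f) ` keys u)" "(snd \<circ> f) ` keys u \<noteq> {}"
    by auto
  obtain x where x: "x \<in> keys u" "fst (f x) = Max ((fst \<circ> f) ` keys u)"
    using Max_in[OF im(1,2)] by auto
  obtain y where y: "y \<in> keys u" "snd (f y) = Max ((snd \<circ> f) ` keys u)"
    using Max_in[OF im(3,4)] by auto
  have "fst (f y) \<le> fst (f x)" "snd (f x) \<le> snd (f y)"
    unfolding x(2) y(2) using x(1) y(1) im by auto
  then have "f (sup x y) = (fst (f x), snd (f y))"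
    by (simp add: sup_f prod_eq_iff sup_nat_def max_absorb1 max_absorb2)
  then have t: "f (sup x y) = (Max ((fst \<circ> f) ` keys u), Max ((snd \<circ> f) ` keys u))"
    by (simp only: x(2) y(2))
  show ?thesis
  proof (cases "x = y")
    case True
    obtain w where "u = \<epsilon> x + w"
      using x(1) by (rule split_off_key)
    then show ?thesis
      using that[of "sup x y" w] t True congruent_refl by auto
  next
    case False
    obtain w where w: "u = \<epsilon> x + \<epsilon> y + w"
      using x(1) y(1) False by (rule split_off_two_keys)
    have "monomials_congruent K u (\<epsilon> (inf x y) + \<epsilon> (sup x y) + w)"
      unfolding w by (intro congruent_add_right congruent_straighten)
    then show ?thesis
      using that[of "sup x y" "\<epsilon> (inf x y) + w"] t w by (simp add: ac_simps)
  qed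
qed

lemma fibre_degrees_invariant:
  fixes f :: "'a::{finite,lattice} \<Rightarrow> nat \<times> nat"
  assumes "\<And>x y. f (inf x y) = inf (f x) (f y)" "\<And>x y. f (sup x y) = sup (f x) (f y)"
  shows "straightening_invariant (fibre_degrees (fst \<circ> f))"
    and "straightening_invariant (fibre_degrees (snd \<circ> f))"
proof -
  have "straightening_invariant (\<lambda>u. fibre_degrees (fst \<circ> f) u i)"
       "straightening_invariant (\<lambda>u. fibre_degrees (snd \<circ> f) u i)" for i
    unfolding fibre_degrees_def
    by (intro straightening_invariant_weight; simp add: assms sup_nat_def inf_nat_def min_def max_def)+
  then show "straightening_invariant (fibre_degrees (fst \<circ> f))"
    and "straightening_invariant (fibre_degrees (snd \<circ> f))"
    by (auto simp: straightening_invariant_def fun_eq_iff)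
qed

text \<open>
  Equal degrees imply equal last rows and equal last columns, so by injectivity of \<open>f\<close> the factor split
  off by \<open>extract_join_of_support\<close> is the same for both monomials.
\<close>

lemma congruent_if_fibre_degrees_eq:
  fixes f :: "'a::{finite,lattice} \<Rightarrow> nat \<times> nat" and K :: "('a, 'k::field) mpoly itself"
  assumes inj: "inj f" and inf_f: "\<And>x y. f (inf x y) = inf (f x) (f y)"
    and sup_f: "\<And>x y. f (sup x y) = sup (f x) (f y)"
    and "fibre_degrees (fst \<circ> f) u = fibre_degrees (fst \<circ> f) v"
    and "fibre_degrees (snd \<circ> f) u = fibre_degrees (snd \<circ> f) v"
  shows "monomials_congruent K u v"
  using assms(4,5)
proof (induction "total_degree u" arbitrary: u v rule: less_induct)
  case (less u v)
  note im = less.prems[THEN fibre_degrees_eq_imp_image_keys_eq]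
  show ?case
  proof (cases "u = 0")
    case True
    then have "v = 0"
      using im(1) by simp
    then show ?thesis
      using True congruent_refl by blast
  next
    case False
    then have "v \<noteq> 0"
      using im(1) by auto
    obtain t w where u: "monomials_congruent K u (\<epsilon> t + w)" "total_degree u = Suc (total_degree w)"
      "f t = (Max ((fst \<circ> f) ` keys u), Max ((snd \<circ> f) ` keys u))"
      using extract_join_of_support[of f, OF sup_f False] .
    obtain t' w' where v: "monomials_congruent K v (\<epsilon> t' + w')"
      "f t' = (Max ((fst \<circ> f) ` keys v), Max ((snd \<circ> f) ` keys v))"
      using extract_join_of_support[of f, OF sup_f \<open>v \<noteq> 0\<close>] by metis
    have [simp]: "t' = t"
      using injD[OF inj, of t' t] u(3) v(2) im by simp
    note inv = fibre_degrees_invariant[of f, OF inf_f sup_f]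
    have "fibre_degrees (fst \<circ> f) w = fibre_degrees (fst \<circ> f) w'"
      "fibre_degrees (snd \<circ> f) w = fibre_degrees (snd \<circ> f) w'"
      using less.prems congruent_invariant[OF inv(1) u(1)] congruent_invariant[OF inv(2) u(1)]
        congruent_invariant[OF inv(1) v(1)] congruent_invariant[OF inv(2) v(1)]
      by (auto simp: fun_eq_iff fibre_degrees_add)
    then have "monomials_congruent K w w'"
      using u(2) by (intro less.hyps) auto
    then have "monomials_congruent K (\<epsilon> t + w) (\<epsilon> t' + w')"
      by (simp add: congruent_add_left)
    then show ?thesis
      using u(1) v(1) congruent_trans congruent_sym by meson
  qed
qed

lemma planar_imp_squarefree_initial_ideal:
  assumes planar: "planar_distributive TYPE('a::{finite,lattice})" and lt: "monomial_order lt"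
  shows "squarefree_monomial_ideal (initial_ideal lt (lattice_ideal :: ('a, 'k::field) mpoly set))"
proof -
  obtain S :: "(nat \<times> nat) set" and f :: "'a \<Rightarrow> nat \<times> nat" where "bij_betw f UNIV S"
    and hom: "\<And>x y. f (inf x y) = inf (f x) (f y)" "\<And>x y. f (sup x y) = sup (f x) (f y)"
    using planar unfolding planar_distributive_def by blast
  then have inj: "inj f"
    by (simp add: bij_betw_def)
  have sto: "strict_total_order lt"
    using lt by (simp add: monomial_order_def)
  note inv = fibre_degrees_invariant[of f, OF hom]
  let ?cong = "monomials_congruent TYPE(('a, 'k) mpoly)"
  let ?I = "lattice_ideal :: ('a, 'k) mpoly set"
  define M where "M = {u. (\<forall>x. lookup u x \<le> 1) \<and> (\<exists>v. ?cong u v \<and> lt v u)}"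
  have "initial_ideal lt ?I = ideal.span (monomial ` M)"
  proof
    show "ideal.span (monomial ` M) \<subseteq> initial_ideal lt ?I"
    proof (rule ideal.span_minimal)
      show "monomial ` M \<subseteq> initial_ideal lt ?I"
        using congruent_initial[OF sto] by (auto simp: M_def)
      show "ideal.subspace (initial_ideal lt ?I)"
        unfolding initial_ideal_def by (rule ideal.subspace_span)
    qed
    show "initial_ideal lt ?I \<subseteq> ideal.span (monomial ` M)"
      unfolding initial_ideal_def
    proof (rule ideal.span_minimal)
      show "{monomial (initial_monomial lt f) |f. f \<in> ?I \<and> f \<noteq> 0}
          \<subseteq> (ideal.span (monomial ` M) :: ('a, 'k) mpoly set)"
      proof
        fix q :: "('a, 'k) mpoly" assume "q \<in> {monomial (initial_monomial lt f) |f. f \<in> ?I \<and> f \<noteq> 0}"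
        then obtain p where q: "q = monomial (initial_monomial lt p)" and p: "p \<in> ?I" "p \<noteq> 0"
          by blast
        define u where "u = initial_monomial lt p"
        obtain v where v: "v \<in> keys p" "v \<noteq> u"
          "fibre_degrees (fst \<circ> f) v = fibre_degrees (fst \<circ> f) u"
          "fibre_degrees (snd \<circ> f) v = fibre_degrees (snd \<circ> f) u"
          using invariant_companion_of_key[OF straightening_invariant_Pair[OF inv] p(1)
              initial_monomial_greatest(1)[OF sto p(2)]] unfolding u_def by auto
        have "lt v u"
          using initial_monomial_greatest(2)[OF sto p(2)] v(1,2) unfolding u_def by blast
        then obtain u1 v1 w where "u = u1 + w" "\<forall>x. lookup u1 x \<le> 1" "lt v1 u1"
          "fibre_degrees (fst \<circ> f) u1 = fibre_degrees (fst \<circ> f) v1"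
          "fibre_degrees (snd \<circ> f) u1 = fibre_degrees (snd \<circ> f) v1"
          using squarefree_leading_divisor[OF lt v(3,4)[symmetric]] by blast
        moreover from this have "?cong u1 v1"
          by (intro congruent_if_fibre_degrees_eq[of f, OF inj hom])
        ultimately have u: "u = w + u1" "u1 \<in> M"
          by (auto simp: M_def add.commute)
        have "(monomial w * monomial u1 :: ('a, 'k) mpoly) \<in> ideal.span (monomial ` M)"
          using u(2) by (intro ideal.span_scale ideal.span_base) blast
        then show "q \<in> ideal.span (monomial ` M)"
          using u(1) by (simp add: q u_def[symmetric] monomial_add)
      qed
    qed (rule ideal.subspace_span)
  qed
  moreover have "\<forall>u\<in>M. \<forall>x. lookup u x \<le> 1"
    by (simp add: M_def)
  ultimately show ?thesis
    unfolding squarefree_monomial_ideal_def by (intro exI[of _ M] conjI)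
qed

section \<open>The height function of a finite modular lattice\<close>

lemma modular_law:
  assumes "modular_lattice TYPE('a::lattice)" "(x :: 'a) \<le> b"
  shows "sup x (inf a b) = inf (sup x a) b"
  using assms unfolding modular_lattice_def by blast

lemma modular_cancel:
  assumes M: "modular_lattice TYPE('a::lattice)" and "(c :: 'a) \<le> d"
    "inf y c = inf y d" "sup y c = sup y d"
  shows "c = d"
proof -
  have "d = inf (sup c y) d"
    by (metis assms(4) inf_sup_absorb inf_commute sup_commute)
  also have "\<dots> = sup c (inf y d)"
    using modular_law[OF M assms(2)] by simp
  also have "\<dots> = c"
    by (metis assms(3) inf_commute sup_inf_absorb)
  finally show ?thesis ..
qed

text \<open>
  For \<open>x \<le> y\<close> this is one more than the length of the interval from \<open>x\<close> to \<open>y\<close>.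
\<close>

definition max_chain_card :: "'a::{finite,lattice} \<Rightarrow> 'a \<Rightarrow> nat" where
  "max_chain_card x y = Max (card ` {C. C \<subseteq> {x..y} \<and> Complete_Partial_Order.chain (\<le>) C})"

lemma max_chain_card_ge:
  fixes x y :: "'a::{finite,lattice}"
  assumes "C \<subseteq> {x..y}" "Complete_Partial_Order.chain (\<le>) C"
  shows "card C \<le> max_chain_card x y"
  unfolding max_chain_card_def using assms by (intro Max_ge) auto

lemma max_chain_card_attained:
  fixes x y :: "'a::{finite,lattice}"
  obtains C where "C \<subseteq> {x..y}" "Complete_Partial_Order.chain (\<le>) C" "card C = max_chain_card x y"
proof -
  let ?S = "{C. C \<subseteq> {x..y} \<and> Complete_Partial_Order.chain (\<le>) C}"
  have "{} \<in> ?S"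
    by (simp add: Complete_Partial_Order.chain_def)
  then have "card ` ?S \<noteq> {}"
    by blast
  then have "Max (card ` ?S) \<in> card ` ?S"
    by (intro Max_in) simp_all
  then show ?thesis
    using that unfolding max_chain_card_def by auto
qed

lemma max_chain_card_mono:
  fixes f :: "'a::{finite,lattice} \<Rightarrow> 'a"
  assumes "mono f" "inj_on f {x..y}" "f ` {x..y} \<subseteq> {x'..y'}"
  shows "max_chain_card x y \<le> max_chain_card x' y'"
proof -
  obtain C where C: "C \<subseteq> {x..y}" "Complete_Partial_Order.chain (\<le>) C" "card C = max_chain_card x y"
    by (rule max_chain_card_attained)
  have "Complete_Partial_Order.chain (\<le>) (f ` C)"
    using C(2) assms(1) unfolding Complete_Partial_Order.chain_def mono_def by blast
  then have "card (f ` C) \<le> max_chain_card x' y'"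
    using C(1) assms(3) by (intro max_chain_card_ge) auto
  moreover have "card (f ` C) = card C"
    using inj_on_subset[OF assms(2) C(1)] by (rule card_image)
  ultimately show ?thesis
    using C(3) by simp
qed

text \<open>
  By the modular law each step up in the chain is a proper step after taking the meet with \<open>y\<close> or after
  taking the join with \<open>y\<close>.  The function \<open>g\<close> counts the steps made so far in both projections; it is
  strictly increasing, starts at 2 and is bounded by the right-hand side.
\<close>

lemma card_chain_le_projections:
  fixes C :: "'a::{finite,lattice} set"
  assumes M: "modular_lattice TYPE('a)" and C: "Complete_Partial_Order.chain (\<le>) C" "C \<noteq> {}"
  shows "card C + 1 \<le> card (inf y ` C) + card (sup y ` C)"
proof -
  define D where "D c = {d \<in> C. d \<le> c}" for c
  define g where "g c = card (inf y ` D c) + card (sup y ` D c)" for c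
  have less: "g c < g c'" if "c \<in> C" "c' \<in> C" "c \<le> c'" "c \<noteq> c'" for c c'
  proof -
    have sub: "D c \<subseteq> D c'" and c': "c' \<in> D c'"
      using that by (auto simp: D_def)
    have "g c \<le> g c'"
      unfolding g_def using sub by (intro add_mono card_mono image_mono) auto
    moreover have "g c \<noteq> g c'"
    proof
      assume eq: "g c = g c'"
      have le: "card (inf y ` D c) \<le> card (inf y ` D c')" "card (sup y ` D c) \<le> card (sup y ` D c')"
        using sub by (intro card_mono image_mono; simp)+
      have "inf y ` D c = inf y ` D c'" "sup y ` D c = sup y ` D c'"
        using sub le eq by (intro card_subset_eq image_mono; simp add: g_def)+
      then have "inf y c' \<in> inf y ` D c" "sup y c' \<in> sup y ` D c"
        using c' by auto
      moreover have "inf y d \<le> inf y c" "sup y d \<le> sup y c" if "d \<in> D c" for d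
        using that by (simp_all add: D_def le_infI2 le_supI2)
      ultimately have "inf y c' \<le> inf y c" "sup y c' \<le> sup y c"
        by (metis imageE)+
      then have "inf y c = inf y c'" "sup y c = sup y c'"
        using that(3) by (auto intro!: order.antisym intro: le_infI2 le_supI2)
      then show False
        using modular_cancel[OF M that(3)] that(4) by blast
    qed
    ultimately show ?thesis by simp
  qed
  have "inj_on g C"
  proof (rule inj_onI, rule ccontr)
    fix c c' assume c: "c \<in> C" "c' \<in> C" "g c = g c'" "c \<noteq> c'"
    then have "c \<le> c' \<or> c' \<le> c"
      using C(1) by (auto simp: Complete_Partial_Order.chain_def)
    then show False
      using less[of c c'] less[of c' c] c by auto
  qed
  have "g ` C \<subseteq> {2..card (inf y ` C) + card (sup y ` C)}"
  proof
    fix k assume "k \<in> g ` C"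
    then obtain c where c: "c \<in> C" "k = g c" by blast
    then have "D c \<noteq> {}" by (auto simp: D_def)
    then have "card (inf y ` D c) \<ge> 1" "card (sup y ` D c) \<ge> 1"
      by (simp_all add: Suc_le_eq card_gt_0_iff)
    moreover have "card (inf y ` D c) \<le> card (inf y ` C)" "card (sup y ` D c) \<le> card (sup y ` C)"
      by (intro card_mono image_mono; auto simp: D_def)+
    ultimately show "k \<in> {2..card (inf y ` C) + card (sup y ` C)}"
      by (simp add: c(2) g_def)
  qed
  then have "card (g ` C) \<le> card {2..card (inf y ` C) + card (sup y ` C)}"
    by (intro card_mono) simp_all
  moreover have "card (g ` C) = card C"
    using \<open>inj_on g C\<close> by (rule card_image)
  moreover have "card C \<ge> 1"
    using C(2) by (simp add: Suc_le_eq card_gt_0_iff)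
  ultimately show ?thesis by simp
qed

lemma max_chain_card_additive:
  fixes x y z :: "'a::{finite,lattice}"
  assumes M: "modular_lattice TYPE('a)" and "x \<le> y" "y \<le> z"
  shows "max_chain_card x z + 1 = max_chain_card x y + max_chain_card y z"
proof (rule order.antisym)
  obtain C where C: "C \<subseteq> {x..z}" "Complete_Partial_Order.chain (\<le>) C" "card C = max_chain_card x z"
    by (rule max_chain_card_attained)
  have "{x} \<subseteq> {x..z}" "Complete_Partial_Order.chain (\<le>) {x}"
    using assms by (auto simp: Complete_Partial_Order.chain_def)
  then have "card {x} \<le> max_chain_card x z"
    by (rule max_chain_card_ge)
  then have "C \<noteq> {}"
    using C(3) by auto
  have "card (inf y ` C) \<le> max_chain_card x y"
  proof (rule max_chain_card_ge)
    show "inf y ` C \<subseteq> {x..y}"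
      using C(1) assms(2) by auto
    show "Complete_Partial_Order.chain (\<le>) (inf y ` C)"
      using C(2) unfolding Complete_Partial_Order.chain_def by (blast intro: inf_mono)
  qed
  moreover have "card (sup y ` C) \<le> max_chain_card y z"
  proof (rule max_chain_card_ge)
    show "sup y ` C \<subseteq> {y..z}"
      using C(1) assms(3) by auto
    show "Complete_Partial_Order.chain (\<le>) (sup y ` C)"
      using C(2) unfolding Complete_Partial_Order.chain_def by (blast intro: sup_mono)
  qed
  ultimately show "max_chain_card x z + 1 \<le> max_chain_card x y + max_chain_card y z"
    using card_chain_le_projections[OF M C(2) \<open>C \<noteq> {}\<close>, of y] C(3) by simp
next
  obtain C where C: "C \<subseteq> {x..y}" "Complete_Partial_Order.chain (\<le>) C" "card C = max_chain_card x y"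
    by (rule max_chain_card_attained)
  obtain D where D: "D \<subseteq> {y..z}" "Complete_Partial_Order.chain (\<le>) D" "card D = max_chain_card y z"
    by (rule max_chain_card_attained)
  have CD: "c \<le> d" if "c \<in> C" "d \<in> D" for c d
    using that C(1) D(1) by (meson atLeastAtMost_iff order_trans subsetD)
  have "Complete_Partial_Order.chain (\<le>) (C \<union> D)"
    using C(2) D(2) CD unfolding Complete_Partial_Order.chain_def by blast
  moreover have "C \<union> D \<subseteq> {x..z}"
    using C(1) D(1) assms(2,3) by fastforce
  ultimately have "card (C \<union> D) \<le> max_chain_card x z"
    by (intro max_chain_card_ge)
  moreover have "card (C \<inter> D) \<le> card {y}"
  proof (rule card_mono)
    show "C \<inter> D \<subseteq> {y}"
    proof
      fix c assume "c \<in> C \<inter> D"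
      then have "c \<le> y" "y \<le> c"
        using C(1) D(1) by auto
      then show "c \<in> {y}" by simp
    qed
  qed simp
  moreover have "card (C \<union> D) + card (C \<inter> D) = card C + card D"
    by (rule card_Un_Int[symmetric]) simp_all
  ultimately show "max_chain_card x y + max_chain_card y z \<le> max_chain_card x z + 1"
    using C(3) D(3) by simp
qed

text \<open>
  The isomorphism between transposed intervals of a modular lattice, \<open>c \<mapsto> b \<and> c\<close> with inverse
  \<open>c \<mapsto> a \<or> c\<close>.
\<close>

lemma max_chain_card_transposed:
  fixes a b :: "'a::{finite,lattice}"
  assumes M: "modular_lattice TYPE('a)"
  shows "max_chain_card a (sup a b) = max_chain_card (inf a b) b"
proof (rule order.antisym)
  have up: "sup a (inf b c) = c" if "c \<in> {a..sup a b}" for c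
    using modular_law[OF M, of a c b] that by (simp add: inf_absorb2)
  have down: "inf b (sup a c) = c" if "c \<in> {inf a b..b}" for c
    using modular_law[OF M, of c b a] that by (simp add: sup_absorb1 inf_commute sup_commute)
  show "max_chain_card a (sup a b) \<le> max_chain_card (inf a b) b"
  proof (rule max_chain_card_mono)
    show "mono (inf b)"
      by (intro monoI inf_mono) auto
    show "inj_on (inf b) {a..sup a b}"
      by (rule inj_on_inverseI[of _ "sup a"]) (rule up)
    show "inf b ` {a..sup a b} \<subseteq> {inf a b..b}"
      by (auto intro: le_infI1 le_infI2)
  qed
  show "max_chain_card (inf a b) b \<le> max_chain_card a (sup a b)"
  proof (rule max_chain_card_mono)
    show "mono (sup a)"
      by (intro monoI sup_mono) auto
    show "inj_on (sup a) {inf a b..b}"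
      by (rule inj_on_inverseI[of _ "inf b"]) (rule down)
    show "sup a ` {inf a b..b} \<subseteq> {a..sup a b}"
      by (auto intro: le_supI1 le_supI2)
  qed
qed

lemma finite_lattice_has_least: "\<exists>z::'a::{finite,lattice}. \<forall>x. z \<le> x"
  using Inf_fin.coboundedI[of "UNIV :: 'a set"] by (intro exI[of _ "Inf_fin UNIV"]) simp

text \<open>
  A strictly monotone valuation gives a weight that is invariant under rewriting and separates the
  elements of a chain.
\<close>

lemma modular_height:
  assumes M: "modular_lattice TYPE('a::{finite,lattice})"
  obtains h :: "'a::{finite,lattice} \<Rightarrow> nat" where "\<And>a b. h a + h b = h (inf a b) + h (sup a b)"
    "\<And>a b. a < b \<Longrightarrow> h a < h b"
proof -
  obtain z :: 'a where z: "\<And>x. z \<le> x"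
    using finite_lattice_has_least by blast
  show ?thesis
  proof (rule that[of "max_chain_card z"])
    fix a b :: 'a
    show "max_chain_card z a + max_chain_card z b = max_chain_card z (inf a b) + max_chain_card z (sup a b)"
      using max_chain_card_additive[OF M z, of a "sup a b"] max_chain_card_additive[OF M z, of "inf a b" b]
        max_chain_card_transposed[OF M, of a b] by simp
  next
    fix a b :: 'a assume "a < b"
    have "card {a, b} \<le> max_chain_card a b"
      using \<open>a < b\<close> by (intro max_chain_card_ge) (auto simp: Complete_Partial_Order.chain_def)
    then show "max_chain_card z a < max_chain_card z b"
      using max_chain_card_additive[OF M z less_imp_le[OF \<open>a < b\<close>]] \<open>a < b\<close> by simp
  qed
qed

section \<open>Distributivity from cancellation\<close>

definition distributive_lattice :: "'a::lattice itself \<Rightarrow> bool" where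
  "distributive_lattice _ \<longleftrightarrow> (\<forall>a b c :: 'a. inf a (sup b c) = sup (inf a b) (inf a c))"

text \<open>
  Put \<open>B = (b \<and> c) \<or> (a \<and> (b \<or> c))\<close> and let \<open>B'\<close> arise from it by exchanging \<open>a\<close> and \<open>b\<close>.  The modular
  law gives \<open>c \<and> B = (b \<and> c) \<or> (a \<and> c)\<close> and \<open>c \<or> B = (c \<or> a) \<and> (b \<or> c)\<close>, both symmetric in \<open>a\<close> and
  \<open>b\<close>, so \<open>B = B'\<close> by cancellation.  Taking the meet with \<open>a\<close> turns \<open>B = B'\<close> into the distributive law.
\<close>

lemma modular_cancellative_imp_distributive:
  assumes M: "modular_lattice TYPE('a::lattice)"
    and cancel: "\<And>a b c :: 'a. inf a b = inf a c \<Longrightarrow> sup a b = sup a c \<Longrightarrow> b = c"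
  shows "distributive_lattice TYPE('a)"
  unfolding distributive_lattice_def
proof (intro allI)
  fix a b c :: 'a
  note law = modular_law[OF M]
  define B where "B x y = sup (inf y c) (inf x (sup y c))" for x y
  have "inf c (B x y) = sup (inf y c) (inf x c)" for x y
  proof -
    have "inf c (B x y) = sup (inf y c) (inf (inf x (sup y c)) c)"
      unfolding B_def by (subst law) (simp_all add: inf_commute)
    also have "inf (inf x (sup y c)) c = inf x c"
      by (simp add: inf_assoc inf_absorb2)
    finally show ?thesis .
  qed
  then have "inf c (B a b) = inf c (B b a)"
    by (simp add: sup_commute)
  moreover have "sup c (B x y) = inf (sup c x) (sup y c)" for x y
  proof -
    have "sup c (B x y) = sup c (inf x (sup y c))"
      unfolding B_def by (simp add: sup_assoc[symmetric] sup_absorb1)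
    also have "\<dots> = inf (sup c x) (sup y c)"
      by (rule law) simp
    finally show ?thesis .
  qed
  then have "sup c (B a b) = sup c (B b a)"
    by (simp add: inf_commute sup_commute)
  ultimately have eq: "B a b = B b a"
    by (rule cancel)
  have "inf a (B a b) = inf a (sup b c)"
  proof -
    have "inf a (B a b) = inf (sup (inf a (sup b c)) (inf b c)) a"
      by (simp add: B_def inf_commute sup_commute)
    also have "\<dots> = sup (inf a (sup b c)) (inf (inf b c) a)"
      by (subst law) simp_all
    also have "inf (inf b c) a \<le> inf a (sup b c)"
      by (simp add: le_infI1 le_supI1)
    then have "sup (inf a (sup b c)) (inf (inf b c) a) = inf a (sup b c)"
      by (rule sup_absorb1)
    finally show ?thesis .
  qed
  moreover have "inf a (B b a) = sup (inf a b) (inf a c)"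
  proof -
    have "inf a (B b a) = inf (sup (inf a c) (inf b (sup a c))) a"
      by (simp add: B_def inf_commute)
    also have "\<dots> = sup (inf a c) (inf (inf b (sup a c)) a)"
      by (subst law) simp_all
    also have "inf (inf b (sup a c)) a = inf a b"
      by (metis inf_assoc inf_commute inf_sup_absorb)
    finally show ?thesis
      by (simp add: sup_commute)
  qed
  ultimately show "inf a (sup b c) = sup (inf a b) (inf a c)"
    using eq by simp
qed

lemma distributive_dual:
  assumes "distributive_lattice TYPE('a::lattice)"
  shows "sup (a::'a) (inf b c) = inf (sup a b) (sup a c)"
proof -
  have d: "inf x (sup y z) = sup (inf x y) (inf x z)" for x y z :: 'a
    using assms by (simp add: distributive_lattice_def)
  have "inf (sup a b) (sup a c) = sup (inf (sup a b) a) (inf (sup a b) c)"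
    by (rule d)
  also have "inf (sup a b) a = a"
    by (simp add: inf_absorb2)
  also have "inf (sup a b) c = sup (inf c a) (inf c b)"
    by (metis d inf_commute)
  also have "sup a (sup (inf c a) (inf c b)) = sup a (inf b c)"
    by (simp add: sup_assoc[symmetric] sup_absorb1 inf_commute)
  finally show ?thesis ..
qed

section \<open>Two chains of join-primes give a planar embedding\<close>

text \<open>
  Galvin's induction.  Remove a maximal element \<open>m\<close> and cover the rest by chains \<open>A\<close> and \<open>B\<close>.  Let \<open>x\<close>
  be the greatest element of \<open>A\<close> that is incomparable to some element of \<open>B\<close>, and \<open>y\<close> the
  greatest element of \<open>B\<close> that is incomparable to some element of \<open>A\<close>.  Then \<open>x\<close> and \<open>y\<close> are
  incomparable, so \<open>m\<close> lies above one of them, say \<open>x\<close>.  The elements of \<open>A\<close> above \<open>x\<close> can be moved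
  to \<open>B\<close>, and \<open>m\<close> can be put on top of what remains of \<open>A\<close>.
\<close>

lemma width_two_imp_two_chains:
  fixes P :: "'a::order set"
  assumes "finite P"
    and "\<And>x y z. x \<in> P \<Longrightarrow> y \<in> P \<Longrightarrow> z \<in> P \<Longrightarrow>
      x \<le> y \<or> y \<le> x \<or> x \<le> z \<or> z \<le> x \<or> y \<le> z \<or> z \<le> y"
  shows "\<exists>A B. P = A \<union> B \<and> Complete_Partial_Order.chain (\<le>) A \<and> Complete_Partial_Order.chain (\<le>) B"
  using assms
proof (induction P rule: finite_psubset_induct)
  case (psubset P)
  let ?chain = "Complete_Partial_Order.chain (\<le>) :: 'a set \<Rightarrow> bool"
  show ?case
  proof (cases "P = {}")
    case True
    then show ?thesis by (auto simp: Complete_Partial_Order.chain_def)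
  next
    case False
    then obtain m where m: "m \<in> P" "\<And>x. x \<in> P \<Longrightarrow> m \<le> x \<Longrightarrow> m = x"
      using finite_has_maximal[OF psubset.hyps(1)] by blast
    have "\<exists>A B. P - {m} = A \<union> B \<and> ?chain A \<and> ?chain B"
    proof (rule psubset.IH)
      show "P - {m} \<subset> P" using m(1) by blast
      show "x \<le> y \<or> y \<le> x \<or> x \<le> z \<or> z \<le> x \<or> y \<le> z \<or> z \<le> y"
        if "x \<in> P - {m}" "y \<in> P - {m}" "z \<in> P - {m}" for x y z
        by (rule psubset.prems) (use that in simp_all)
    qed
    then obtain A B where AB: "P - {m} = A \<union> B" "?chain A" "?chain B"
      by (elim exE conjE)
    have greatest: "\<exists>x\<in>X. \<forall>y\<in>X. y \<le> x" if X: "X \<subseteq> A \<or> X \<subseteq> B" "X \<noteq> {}" for X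
    proof -
      have "X \<subseteq> P"
        using X(1) AB(1) by auto
      then have "finite X"
        using psubset.hyps(1) by (rule finite_subset)
      then obtain x where x: "x \<in> X" "\<forall>y\<in>X. x \<le> y \<longrightarrow> x = y"
        using finite_has_maximal[OF _ X(2)] by blast
      have "?chain X"
        using X(1) AB(2,3) by (auto intro: chain_subset)
      then have "y \<le> x" if "y \<in> X" for y
        using x that chainD[of "(\<le>)" X x y] by auto
      then show ?thesis
        using x(1) by blast
    qed
    have extend: "\<exists>A' B'. P = A' \<union> B' \<and> ?chain A' \<and> ?chain B'"
      if CD: "C \<union> D = P - {m}" "?chain C" "?chain D" and c: "c \<le> m"
        and comp: "\<And>z y. z \<in> C \<Longrightarrow> \<not> z \<le> c \<Longrightarrow> y \<in> D \<Longrightarrow> z \<le> y \<or> y \<le> z" for C D c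
    proof (intro exI conjI)
      show "P = insert m {z \<in> C. z \<le> c} \<union> (D \<union> {z \<in> C. \<not> z \<le> c})"
        using CD(1) m(1) by blast
      show "?chain (insert m {z \<in> C. z \<le> c})"
        using CD(2) c unfolding Complete_Partial_Order.chain_def by (auto intro: order_trans)
      show "?chain (D \<union> {z \<in> C. \<not> z \<le> c})"
        using CD(2,3) comp unfolding Complete_Partial_Order.chain_def by blast
    qed
    let ?inc = "\<lambda>x y. \<not> x \<le> y \<and> \<not> y \<le> x"
    define X Y where "X = {x \<in> A. \<exists>y\<in>B. ?inc x y}" and "Y = {y \<in> B. \<exists>x\<in>A. ?inc x y}"
    show ?thesis
    proof (cases "X = {}")
      case True
      then have "?chain (A \<union> B)"
        using AB(2,3) unfolding X_def Complete_Partial_Order.chain_def by blast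
      moreover have "?chain {m}"
        by (simp add: Complete_Partial_Order.chain_def)
      moreover have "P = (A \<union> B) \<union> {m}"
        using AB(1) m(1) by blast
      ultimately show ?thesis by blast
    next
      case False
      then have "Y \<noteq> {}"
        unfolding X_def Y_def by blast
      obtain x where x: "x \<in> X" "\<forall>x'\<in>X. x' \<le> x"
        using greatest[of X] False unfolding X_def by blast
      obtain y where y: "y \<in> Y" "\<forall>y'\<in>Y. y' \<le> y"
        using greatest[of Y] \<open>Y \<noteq> {}\<close> unfolding Y_def by blast
      obtain y' where y': "y' \<in> B" "?inc x y'" "y' \<in> Y"
        using x(1) unfolding X_def Y_def by blast
      obtain x' where x': "x' \<in> A" "?inc x' y" "x' \<in> X"
        using y(1) unfolding X_def Y_def by blast
      have "?inc x y"
        using x(2) y(2) x' y' by (meson order_trans)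
      moreover have "x \<in> P" "y \<in> P" "x \<noteq> m" "y \<noteq> m"
        using x(1) y(1) AB(1) unfolding X_def Y_def by blast+
      ultimately have "x \<le> m \<or> y \<le> m"
        using psubset.prems[OF \<open>x \<in> P\<close> \<open>y \<in> P\<close> m(1)] m(2) by blast
      then show ?thesis
      proof
        assume "x \<le> m"
        then show ?thesis
          using AB x(2) by (intro extend[of A B x]) (auto simp: X_def)
      next
        assume "y \<le> m"
        then show ?thesis
          using AB y(2) by (intro extend[of B A y]) (auto simp: Y_def)
      qed
    qed
  qed
qed

text \<open>
  The first condition excludes exactly the least element; without it the embedding into \<open>\<nat>\<^sup>2\<close> would
  not reach the origin.
\<close>

definition join_prime :: "'a::lattice \<Rightarrow> bool" where
  "join_prime p \<longleftrightarrow> (\<exists>x. \<not> p \<le> x) \<and> (\<forall>a b. p \<le> sup a b \<longrightarrow> p \<le> a \<or> p \<le> b)"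

lemma join_prime_le_sup_iff: "join_prime p \<Longrightarrow> p \<le> sup a b \<longleftrightarrow> p \<le> a \<or> p \<le> b"
  unfolding join_prime_def by (auto intro: le_supI1 le_supI2)

text \<open>
  A minimal element among those below \<open>a\<close> but not below \<open>b\<close> is join-prime.
\<close>

lemma separating_join_prime:
  fixes a b :: "'a::{finite,lattice}"
  assumes D: "distributive_lattice TYPE('a)" and "\<not> a \<le> b"
  obtains p where "join_prime p" "p \<le> a" "\<not> p \<le> b"
proof -
  have "finite {x. x \<le> a \<and> \<not> x \<le> b}" "{x. x \<le> a \<and> \<not> x \<le> b} \<noteq> {}"
    using assms(2) by auto
  then obtain p where p: "p \<le> a" "\<not> p \<le> b" "\<And>x. x \<le> a \<Longrightarrow> \<not> x \<le> b \<Longrightarrow> x \<le> p \<Longrightarrow> p = x"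
    using finite_has_minimal[of "{x. x \<le> a \<and> \<not> x \<le> b}"] by auto
  have "p \<le> c \<or> p \<le> d" if "p \<le> sup c d" for c d
  proof (rule ccontr)
    assume "\<not> (p \<le> c \<or> p \<le> d)"
    then have "inf p c \<noteq> p" "inf p d \<noteq> p"
      by (auto simp: inf.orderI order.order_iff_strict dest: inf.orderI[OF sym])
    then have "inf p c \<le> b" "inf p d \<le> b"
      using p(3)[of "inf p c"] p(3)[of "inf p d"] p(1) by (auto simp: le_infI1)
    moreover have "p = sup (inf p c) (inf p d)"
      using D that unfolding distributive_lattice_def by (metis inf.absorb1)
    ultimately show False
      using p(2) by (metis le_supI)
  qed
  then have "join_prime p"
    using p(2) unfolding join_prime_def by blast
  then show ?thesis
    using that p(1,2) by blast
qed

text \<open>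
  The sets \<open>D x\<close> are down-sets of a chain, hence nested and determined by their cardinality.  Meets
  always go to intersections, and joins go to unions by primality.
\<close>

lemma count_in_chain_of_join_primes:
  fixes A :: "'a::{finite,lattice} set"
  assumes "Complete_Partial_Order.chain (\<le>) A" "\<And>p. p \<in> A \<Longrightarrow> join_prime p"
  defines "D \<equiv> \<lambda>x. {p \<in> A. p \<le> x}"
  shows "card (D (inf x y)) = inf (card (D x)) (card (D y))"
    and "card (D (sup x y)) = sup (card (D x)) (card (D y))"
    and "card (D x) = card (D y) \<Longrightarrow> D x = D y"
proof -
  have nested: "D x \<subseteq> D y \<or> D y \<subseteq> D x"
    using assms(1) unfolding D_def Complete_Partial_Order.chain_def by (blast intro: order_trans)
  have "D (inf x y) = D x \<inter> D y"
    by (auto simp: D_def)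
  moreover have "D (sup x y) = D x \<union> D y"
    using join_prime_le_sup_iff assms(2) by (auto simp: D_def)
  moreover have "D x \<subseteq> D y \<Longrightarrow> card (D x) \<le> card (D y)" "D y \<subseteq> D x \<Longrightarrow> card (D y) \<le> card (D x)"
    by (simp_all add: card_mono)
  ultimately show "card (D (inf x y)) = inf (card (D x)) (card (D y))"
    and "card (D (sup x y)) = sup (card (D x)) (card (D y))"
    using nested by (auto simp: inf_absorb1 inf_absorb2 sup_absorb1 sup_absorb2 Un_absorb1 Un_absorb2 Int_absorb1 Int_absorb2)
  show "D x = D y" if "card (D x) = card (D y)"
    using nested that card_subset_eq[of "D x" "D y"] card_subset_eq[of "D y" "D x"] by auto
qed

lemma planar_distributive_if_two_chains:
  assumes D: "distributive_lattice TYPE('a::{finite,lattice})"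
    and AB: "{p :: 'a. join_prime p} = A \<union> B" "Complete_Partial_Order.chain (\<le>) A"
      "Complete_Partial_Order.chain (\<le>) B"
  shows "planar_distributive TYPE('a)"
proof -
  define a b where "a x = {p \<in> A. p \<le> x}" and "b x = {p \<in> B. p \<le> x}" for x
  define f where "f x = (card (a x), card (b x))" for x
  have prime: "\<And>p. p \<in> A \<Longrightarrow> join_prime p" "\<And>p. p \<in> B \<Longrightarrow> join_prime p"
    using AB(1) by blast+
  note cA = count_in_chain_of_join_primes[OF AB(2) prime(1), folded a_def]
  note cB = count_in_chain_of_join_primes[OF AB(3) prime(2), folded b_def]
  have hom: "f (inf x y) = inf (f x) (f y)" "f (sup x y) = sup (f x) (f y)" for x y
    by (simp_all add: f_def cA(1,2) cB(1,2))
  have le: "x \<le> y" if "f x = f y" for x y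
  proof (rule ccontr)
    assume "\<not> x \<le> y"
    then obtain p where p: "join_prime p" "p \<le> x" "\<not> p \<le> y"
      using separating_join_prime[OF D] by blast
    moreover have "a x = a y" "b x = b y"
      using that cA(3) cB(3) by (simp_all add: f_def)
    ultimately show False
      using AB(1) unfolding a_def b_def by blast
  qed
  have "inj f"
    by (rule injI, rule order.antisym) (auto intro: le)
  obtain z :: 'a where z: "\<And>x. z \<le> x"
    using finite_lattice_has_least by blast
  \<comment> \<open>No join-prime lies below the least element, which therefore goes to the origin.\<close>
  have "\<not> join_prime p" if "p \<le> z" for p
    using that z order_trans unfolding join_prime_def by blast
  then have "a z = {}" "b z = {}"
    using prime unfolding a_def b_def by blast+
  then have "f z = (0, 0)"
    by (simp add: f_def)
  show ?thesis
    unfolding planar_distributive_def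
  proof (intro exI conjI allI)
    show "finite (range f)" by simp
    show "sublattice (range f)"
      unfolding sublattice_def using hom by (metis (no_types, lifting) imageE rangeI)
    show "(0, 0) \<in> range f"
      using \<open>f z = (0, 0)\<close> by (metis rangeI)
    show "bij_betw f UNIV (range f)"
      using \<open>inj f\<close> by (simp add: bij_betw_def)
  qed (rule hom)+
qed

text \<open>
  Without two covering chains there are three pairwise incomparable join-primes \<open>p, q, r\<close>.  Take
  \<open>x = p \<or> q\<close>, \<open>y = p \<or> r\<close> and \<open>z = q \<or> r\<close>: then \<open>p\<close> lies below \<open>x\<close> and \<open>y\<close> but, being prime, not
  below \<open>z\<close>, and similarly for \<open>q\<close> and \<open>r\<close>.  So \<open>x, y, z\<close> are the coatoms of a Boolean lattice of rank
  three.
\<close>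

lemma nonplanar_distributive_configuration:
  assumes D: "distributive_lattice TYPE('a::{finite,lattice})" and "\<not> planar_distributive TYPE('a)"
  obtains x y z T :: "'a::{finite,lattice}" where
    "sup x y = T" "sup x z = T" "sup y z = T"
    "\<not> inf x y \<le> z" "\<not> inf x z \<le> y" "\<not> inf y z \<le> x"
proof -
  let ?P = "{p :: 'a. join_prime p}"
  have "\<not> (\<forall>x\<in>?P. \<forall>y\<in>?P. \<forall>z\<in>?P. x \<le> y \<or> y \<le> x \<or> x \<le> z \<or> z \<le> x \<or> y \<le> z \<or> z \<le> y)"
  proof
    assume "\<forall>x\<in>?P. \<forall>y\<in>?P. \<forall>z\<in>?P. x \<le> y \<or> y \<le> x \<or> x \<le> z \<or> z \<le> x \<or> y \<le> z \<or> z \<le> y"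
    then have "\<exists>A B. ?P = A \<union> B \<and> Complete_Partial_Order.chain (\<le>) A \<and> Complete_Partial_Order.chain (\<le>) B"
      by (intro width_two_imp_two_chains) auto
    then show False
      using planar_distributive_if_two_chains[OF D] assms(2) by blast
  qed
  then obtain p q r :: 'a where pr: "join_prime p" "join_prime q" "join_prime r"
    and inc: "\<not> p \<le> q" "\<not> q \<le> p" "\<not> p \<le> r" "\<not> r \<le> p" "\<not> q \<le> r" "\<not> r \<le> q"
    by blast
  show ?thesis
  proof (rule that[of "sup p q" "sup p r" "sup p (sup q r)" "sup q r"])
    show "\<not> inf (sup p q) (sup p r) \<le> sup q r"
      using inc join_prime_le_sup_iff[OF pr(1)] by (meson le_inf_iff order_trans sup_ge1)
    show "\<not> inf (sup p q) (sup q r) \<le> sup p r"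
      using inc join_prime_le_sup_iff[OF pr(2)] by (meson le_inf_iff order_trans sup_ge1 sup_ge2)
    show "\<not> inf (sup p r) (sup q r) \<le> sup p q"
      using inc join_prime_le_sup_iff[OF pr(3)] by (meson le_inf_iff order_trans sup_ge2)
  qed (simp_all add: ac_simps)
qed

section \<open>Squarefree lexicographic initial ideals force planarity\<close>

text \<open>
  Orders of the variables are only ever needed up to their arrangement in blocks.
\<close>

lemma strict_total_order_by_levels:
  fixes l :: "'a::finite \<Rightarrow> nat"
  obtains lt where "strict_total_order lt" "\<And>x y. l x < l y \<Longrightarrow> lt x y"
proof -
  obtain g :: "'a \<Rightarrow> nat" where g: "inj g"
    using finite_imp_inj_to_nat_seg[of "UNIV :: 'a set"] by auto
  define lt where "lt x y \<longleftrightarrow> l x < l y \<or> l x = l y \<and> g x < g y" for x y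
  have "irreflp lt" "transp lt"
    by (auto simp: lt_def intro!: irreflpI transpI)
  moreover have "totalp lt"
  proof (rule totalpI)
    fix x y :: 'a assume "x \<noteq> y"
    then have "g x \<noteq> g y"
      using g by (simp add: inj_eq)
    then show "lt x y \<or> lt y x"
      unfolding lt_def by arith
  qed
  ultimately have "strict_total_order lt"
    by (simp add: strict_total_order_def)
  moreover have "lt x y" if "l x < l y" for x y
    using that by (simp add: lt_def)
  ultimately show ?thesis by (rule that)
qed

lemma lex_smaller_keys_level:
  assumes lt: "strict_total_order lt" "\<And>x y. l x < (l y :: nat) \<Longrightarrow> lt x y"
    and "lex_order lt v u" "\<And>x. x \<in> keys u \<Longrightarrow> l x \<le> n" "y \<in> keys v"
  shows "l y \<le> n"
proof (rule ccontr)
  assume "\<not> l y \<le> n"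
  then have "lt x y" if "x \<in> keys u" for x
    using assms(4)[OF that] lt(2) by simp
  moreover obtain x where x: "lookup v x < lookup u x" "\<forall>z. lt x z \<longrightarrow> lookup v z = lookup u z"
    using assms(3) unfolding lex_order_def by blast
  moreover from x(1) have "x \<in> keys u"
    by (simp add: in_keys_iff)
  ultimately have "y \<in> keys u"
    using assms(5) by (simp add: in_keys_iff)
  then show False
    using assms(4) \<open>\<not> l y \<le> n\<close> by blast
qed

lemma keys_add_nat: "keys (u + v) = keys u \<union> keys (v :: 'a \<Rightarrow>\<^sub>0 nat)"
  by (auto simp: in_keys_iff lookup_add)

text \<open>
  The lower and upper bounds of the support encode its meet and join, but also make sense for the empty
  support in a lattice without top or bottom.
\<close>

definition support_bounds :: "('a::lattice \<Rightarrow>\<^sub>0 nat) \<Rightarrow> 'a set \<times> 'a set" where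
  "support_bounds u = ({z. \<forall>x\<in>keys u. z \<le> x}, {z. \<forall>x\<in>keys u. x \<le> z})"

lemma straightening_invariant_support_bounds: "straightening_invariant support_bounds"
  unfolding straightening_invariant_def
proof (intro allI)
  fix a b :: 'a and w
  have "z \<le> a \<and> z \<le> b \<longleftrightarrow> z \<le> inf a b \<and> z \<le> sup a b" for z
    by (auto intro: le_supI1)
  moreover have "a \<le> z \<and> b \<le> z \<longleftrightarrow> inf a b \<le> z \<and> sup a b \<le> z" for z
    by (auto intro: le_infI1)
  ultimately show "support_bounds (\<epsilon> a + \<epsilon> b + w) = support_bounds (\<epsilon> (inf a b) + \<epsilon> (sup a b) + w)"
    by (auto simp: support_bounds_def keys_add_nat ball_Un)
qed

lemma radical_monomial_eq:
  assumes "keys w = keys u" "\<And>x. lookup w x \<le> 1"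
  shows "radical_monomial u = w"
proof (rule poly_mapping_eqI)
  fix x
  show "lookup (radical_monomial u) x = lookup w x"
    using assms(2)[of x] unfolding lookup_radical_monomial assms(1)[symmetric]
    by (auto simp: in_keys_iff)
qed

text \<open>
  A monomial smaller than \<open>b o t\<close> only involves elements of the chain \<open>o \<le> p < b < q \<le> t\<close>, where
  \<open>p = b \<and> c\<close> and \<open>q = b \<or> c\<close>.  If it is congruent to \<open>b o t\<close>, then comparing meets and joins of the
  supports shows that it has the factors \<open>o\<close> and \<open>t\<close>, and comparing heights shows that its third factor
  is \<open>b\<close>.
\<close>

lemma squarefree_lex_imp_cancellative:
  fixes a b c :: "'a::{finite,lattice}"
  assumes M: "modular_lattice TYPE('a)"
    and sq: "\<And>lt :: 'a \<Rightarrow> 'a \<Rightarrow> bool. strict_total_order lt \<Longrightarrow>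
      squarefree_monomial_ideal (initial_ideal (lex_order lt) (lattice_ideal :: ('a, 'k::field) mpoly set))"
    and inf: "inf a b = inf a c" and sup: "sup a b = sup a c"
  shows "b = c"
proof (rule ccontr)
  assume "b \<noteq> c"
  then have "\<not> b \<le> c" "\<not> c \<le> b"
    using modular_cancel[OF M, of b c a] modular_cancel[OF M, of c b a] inf sup by auto
  define p q O' T where "p = inf b c" and "q = sup b c" and "O' = inf a b" and "T = sup a b"
  have pq: "p < b" "b < q" "p < q"
    using \<open>\<not> b \<le> c\<close> \<open>\<not> c \<le> b\<close> unfolding p_def q_def
    by (auto simp: less_le_not_le intro: le_supI1)
  have OT: "O' \<le> p" "q \<le> T"
    using inf sup unfolding p_def q_def O'_def T_def by (metis inf.cobounded2 le_inf_iff, metis sup.cobounded2 le_sup_iff)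
  have chain: "O' < b" "b < T" "O' < T" "O' < q" "p < T"
    using pq OT by (meson less_le_trans le_less_trans order_trans)+
  obtain h :: "'a \<Rightarrow> nat" where h: "\<And>x y. h x + h y = h (Lattices.inf x y) + h (Lattices.sup x y)"
    "\<And>x y. x < y \<Longrightarrow> h x < h y"
    using modular_height[OF M] by blast
  define l where "l x = (if x \<in> {p, q, O', T} then 0 else if x = b then 1 else 2 :: nat)" for x
  obtain lt where lt: "strict_total_order lt" "\<And>x y. l x < l y \<Longrightarrow> lt x y"
    using strict_total_order_by_levels[of l] by blast
  let ?cong = "monomials_congruent TYPE(('a, 'k) mpoly)"
  let ?u = "\<epsilon> b + \<epsilon> b + (\<epsilon> O' + \<epsilon> T)" and ?v = "\<epsilon> O' + \<epsilon> T + (\<epsilon> p + \<epsilon> q)"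
    and ?r = "\<epsilon> b + \<epsilon> O' + \<epsilon> T"
  have st: "?cong (\<epsilon> a + \<epsilon> b) (\<epsilon> O' + \<epsilon> T)" "?cong (\<epsilon> a + \<epsilon> c) (\<epsilon> O' + \<epsilon> T)"
    "?cong (\<epsilon> b + \<epsilon> c) (\<epsilon> p + \<epsilon> q)"
    using congruent_straighten[of _ a b] congruent_straighten[of _ a c] congruent_straighten[of _ b c]
    by (simp_all add: p_def q_def O'_def T_def inf sup)
  \<comment> \<open>Introduce \<open>a c\<close> in place of \<open>o t\<close>, then rewrite \<open>a b\<close> to \<open>o t\<close> and \<open>b c\<close> to \<open>p q\<close>.\<close>
  have "?cong ?u (\<epsilon> b + \<epsilon> b + (\<epsilon> a + \<epsilon> c))"
    by (intro congruent_add_left congruent_sym[OF st(2)])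
  also have "\<epsilon> b + \<epsilon> b + (\<epsilon> a + \<epsilon> c) = (\<epsilon> a + \<epsilon> b) + (\<epsilon> b + \<epsilon> c)"
    by (simp add: ac_simps)
  finally have cong: "?cong ?u ?v"
    using congruent_trans congruent_add_left[OF st(3)] congruent_add_right[OF st(1)] by meson
  have neq: "b \<notin> {p, q, O', T}" "O' \<noteq> T"
    using pq chain by auto
  have less: "lex_order lt ?v ?u"
    unfolding lex_order_def
  proof (intro exI[of _ b] conjI allI impI)
    show "lookup ?v b < lookup ?u b"
      using neq by (auto simp: lookup_add lookup_single when_def)
    fix y assume "lt b y"
    then have "\<not> lt y b"
      by (rule strict_total_order_asym[OF lt(1)])
    then have "\<not> l y < l b" "y \<noteq> b"
      using lt(2) \<open>lt b y\<close> by blast+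
    then have "y \<notin> {p, q, O', T}" "y \<noteq> b"
      using neq by (auto simp: l_def split: if_splits)
    then show "lookup ?v y = lookup ?u y"
      by (auto simp: lookup_add lookup_single when_def)
  qed
  define \<phi> where "\<phi> w = (support_bounds w, total_degree w, weight h w)" for w :: "'a \<Rightarrow>\<^sub>0 nat"
  have inv: "straightening_invariant \<phi>"
    unfolding \<phi>_def using h(1)
    by (intro straightening_invariant_Pair straightening_invariant_support_bounds
        straightening_invariant_weight) auto
  have "radical_monomial ?u = ?r"
    using neq by (intro radical_monomial_eq) (auto simp: keys_add_nat lookup_add lookup_single when_def)
  then obtain v' where v': "lex_order lt v' ?r" "\<phi> v' = \<phi> ?r"
    using radical_not_least_in_class[OF lex_order_monomial_order[OF lt(1)] sq[OF lt(1)] cong less inv]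
    by auto
  have keys: "keys v' \<subseteq> {p, q, O', T, b}"
  proof
    fix y assume "y \<in> keys v'"
    have "l y \<le> 1"
    proof (rule lex_smaller_keys_level[where l = l, OF lt(1) _ v'(1) _ \<open>y \<in> keys v'\<close>])
      show "l x \<le> 1" if "x \<in> keys ?r" for x
        using that by (auto simp: keys_add_nat l_def split: if_splits)
    qed (rule lt(2))
    then show "y \<in> {p, q, O', T, b}"
      by (auto simp: l_def split: if_splits)
  qed
  have lower: "z \<le> O'" if "\<And>x. x \<in> keys v' \<Longrightarrow> z \<le> x" for z
  proof -
    have "z \<in> fst (support_bounds v')"
      using that by (simp add: support_bounds_def)
    also have "fst (support_bounds v') = fst (support_bounds ?r)"
      using v'(2) by (simp add: \<phi>_def)
    finally show ?thesis
      by (simp add: support_bounds_def keys_add_nat)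
  qed
  have upper: "T \<le> z" if "\<And>x. x \<in> keys v' \<Longrightarrow> x \<le> z" for z
  proof -
    have "z \<in> snd (support_bounds v')"
      using that by (simp add: support_bounds_def)
    also have "snd (support_bounds v') = snd (support_bounds ?r)"
      using v'(2) by (simp add: \<phi>_def)
    finally show ?thesis
      by (simp add: support_bounds_def keys_add_nat)
  qed
  \<comment> \<open>Without the factor \<open>o\<close>, the element \<open>p\<close> or, if \<open>p = o\<close>, the element \<open>b\<close> would be a lower bound
    of the support that is not below \<open>o\<close>; dually for \<open>t\<close>.\<close>
  have "O' \<in> keys v'"
  proof (rule ccontr)
    assume notin: "O' \<notin> keys v'"
    have "p \<le> O'"
      using keys notin pq chain by (intro lower) auto
    then have "p = O'"
      using OT(1) by simp
    then have "b \<le> O'"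
      using keys notin pq chain by (intro lower) auto
    then show False
      using chain(1) by simp
  qed
  moreover have "T \<in> keys v'"
  proof (rule ccontr)
    assume notin: "T \<notin> keys v'"
    have "T \<le> q"
      using keys notin pq chain by (intro upper) auto
    then have "q = T"
      using OT(2) by simp
    then have "T \<le> b"
      using keys notin pq chain by (intro upper) auto
    then show False
      using chain(2) by simp
  qed
  ultimately obtain w where w: "v' = \<epsilon> O' + \<epsilon> T + w"
    using neq(2) by (meson split_off_two_keys)
  then have "total_degree w = Suc 0"
    using v'(2) by (simp add: \<phi>_def)
  then obtain s w0 where s: "w = \<epsilon> s + w0" "total_degree w0 = 0"
    by (rule total_degree_Suc)
  have v's: "v' = \<epsilon> O' + \<epsilon> T + \<epsilon> s"
    using w s(1) s(2)[unfolded total_degree_eq_0_iff] by simp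
  have "h s = h b"
    using v'(2) by (simp add: \<phi>_def v's)
  moreover have "s \<in> {p, q, O', T, b}"
    using keys by (simp add: v's keys_add_nat)
  ultimately have "s = b"
    using h(2) pq chain by fastforce
  then have "v' = ?r"
    by (simp add: v's ac_simps)
  then show False
    using v'(1) by (simp add: lex_order_def)
qed

text \<open>
  A monomial smaller than \<open>t o\<close> only involves \<open>o, x, y, z, t\<close>.  If it is congruent to \<open>t o\<close>, it is a
  product of two of these elements with meet \<open>o\<close> and join \<open>t\<close>; no pair other than \<open>o, t\<close> itself has
  both properties.
\<close>

lemma squarefree_lex_distributive_imp_planar:
  assumes D: "distributive_lattice TYPE('a::{finite,lattice})"
    and sq: "\<And>lt :: 'a \<Rightarrow> 'a \<Rightarrow> bool. strict_total_order lt \<Longrightarrow>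
      squarefree_monomial_ideal (initial_ideal (lex_order lt) (lattice_ideal :: ('a, 'k::field) mpoly set))"
  shows "planar_distributive TYPE('a)"
proof (rule ccontr)
  assume "\<not> planar_distributive TYPE('a)"
  then obtain x y z T :: 'a where T: "sup x y = T" "sup x z = T" "sup y z = T"
    and nle: "\<not> inf x y \<le> z" "\<not> inf x z \<le> y" "\<not> inf y z \<le> x"
    using nonplanar_distributive_configuration[OF D] by metis
  define O' where "O' = inf (inf x y) z"
  have O': "O' \<le> x" "O' \<le> y" "O' \<le> z"
    by (auto simp: O'_def le_infI1)
  have le_T: "x \<le> T" "y \<le> T" "z \<le> T"
    using sup_ge1[of x y] sup_ge2[of y x] sup_ge2[of z y] by (simp_all only: T)
  have xyz_T: "x \<noteq> T" "y \<noteq> T" "z \<noteq> T"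
    using nle le_T by (auto intro: le_infI1 le_infI2)
  have neq: "T \<notin> {O', x, y, z}"
    using xyz_T O' le_T by auto
  define l where "l w = (if w \<in> {O', x, y, z} then 0 else if w = T then 1 else 2 :: nat)" for w
  obtain lt where lt: "strict_total_order lt" "\<And>x y. l x < l y \<Longrightarrow> lt x y"
    using strict_total_order_by_levels[of l] by blast
  let ?cong = "monomials_congruent TYPE(('a, 'k) mpoly)"
  let ?u = "\<epsilon> O' + \<epsilon> T + \<epsilon> T" and ?v = "\<epsilon> x + \<epsilon> y + \<epsilon> z" and ?r = "\<epsilon> O' + \<epsilon> T"
  have "sup (inf x y) z = inf (sup z x) (sup z y)"
    using distributive_dual[OF D, of z x y] by (simp add: sup_commute)
  then have "sup (inf x y) z = T"
    using T by (simp add: sup_commute)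
  then have st: "?cong (\<epsilon> (inf x y) + \<epsilon> z) (\<epsilon> O' + \<epsilon> T)" "?cong (\<epsilon> x + \<epsilon> y) (\<epsilon> (inf x y) + \<epsilon> T)"
    using congruent_straighten[of _ "inf x y" z] congruent_straighten[of _ x y]
    by (simp_all add: O'_def T)
  \<comment> \<open>Rewrite \<open>x y\<close> to \<open>(x \<and> y) t\<close>, then \<open>(x \<and> y) z\<close> to \<open>o t\<close>, using \<open>(x \<and> y) \<or> z = t\<close>.\<close>
  have "?cong ?v (\<epsilon> (inf x y) + \<epsilon> T + \<epsilon> z)"
    by (intro congruent_add_right st(2))
  also have "\<epsilon> (inf x y) + \<epsilon> T + \<epsilon> z = (\<epsilon> (inf x y) + \<epsilon> z) + \<epsilon> T"
    by (simp add: ac_simps)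
  finally have cong: "?cong ?u ?v"
    using congruent_add_right[OF st(1)] congruent_trans congruent_sym by meson
  have less: "lex_order lt ?v ?u"
    unfolding lex_order_def
  proof (intro exI[of _ T] conjI allI impI)
    show "lookup ?v T < lookup ?u T"
      using neq by (auto simp: lookup_add lookup_single when_def)
    fix w assume "lt T w"
    then have "\<not> lt w T"
      by (rule strict_total_order_asym[OF lt(1)])
    then have "\<not> l w < l T" "w \<noteq> T"
      using lt(2) \<open>lt T w\<close> by blast+
    then have "w \<notin> {O', x, y, z}" "w \<noteq> T"
      using neq by (auto simp: l_def split: if_splits)
    then show "lookup ?v w = lookup ?u w"
      by (auto simp: lookup_add lookup_single when_def)
  qed
  define \<phi> where "\<phi> w = (support_bounds w, total_degree w)" for w :: "'a \<Rightarrow>\<^sub>0 nat"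
  have inv: "straightening_invariant \<phi>"
    unfolding \<phi>_def
    by (intro straightening_invariant_Pair straightening_invariant_support_bounds
        straightening_invariant_weight) auto
  have "radical_monomial ?u = ?r"
    using neq by (intro radical_monomial_eq) (auto simp: keys_add_nat lookup_add lookup_single when_def)
  then obtain v' where v': "lex_order lt v' ?r" "\<phi> v' = \<phi> ?r"
    using radical_not_least_in_class[OF lex_order_monomial_order[OF lt(1)] sq[OF lt(1)] cong less inv]
    by auto
  have keys: "keys v' \<subseteq> {O', x, y, z, T}"
  proof
    fix w assume "w \<in> keys v'"
    have "l w \<le> 1"
    proof (rule lex_smaller_keys_level[where l = l, OF lt(1) _ v'(1) _ \<open>w \<in> keys v'\<close>])
      show "l x \<le> 1" if "x \<in> keys ?r" for x
        using that by (auto simp: keys_add_nat l_def split: if_splits)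
    qed (rule lt(2))
    then show "w \<in> {O', x, y, z, T}"
      by (auto simp: l_def split: if_splits)
  qed
  have "total_degree v' = Suc (Suc 0)"
    using v'(2) by (simp add: \<phi>_def)
  then obtain s w1 where s: "v' = \<epsilon> s + w1" "total_degree w1 = Suc 0"
    by (rule total_degree_Suc)
  from s(2) obtain t w0 where t: "w1 = \<epsilon> t + w0" "total_degree w0 = 0"
    by (rule total_degree_Suc)
  have v'st: "v' = \<epsilon> s + \<epsilon> t"
    using s(1) t(1) t(2)[unfolded total_degree_eq_0_iff] by simp
  have st_in: "s \<in> {O', x, y, z, T}" "t \<in> {O', x, y, z, T}"
    using keys by (auto simp: v'st keys_add_nat)
  have bounds: "support_bounds v' = support_bounds ?r"
    using v'(2) by (simp add: \<phi>_def)
  have "O' \<le> T"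
    using O'(1) le_T(1) by (rule order_trans)
  have "{w. w \<le> s \<and> w \<le> t} = {w. w \<le> O'}" "{w. s \<le> w \<and> t \<le> w} = {w. T \<le> w}"
    using bounds \<open>O' \<le> T\<close> by (auto simp: support_bounds_def v'st keys_add_nat intro: order_trans)
  then have "w \<le> inf s t \<longleftrightarrow> w \<le> O'" "sup s t \<le> w \<longleftrightarrow> T \<le> w" for w
    by (auto simp: set_eq_iff)
  then have "inf s t = O'" "sup s t = T"
    by (metis order.antisym order_refl)+
  have "s = T \<or> t = T"
  proof (rule ccontr)
    assume "\<not> (s = T \<or> t = T)"
    then have "{s, t} \<subseteq> {x, y, z}" "s \<noteq> t"
      using st_in \<open>sup s t = T\<close> O' by (auto simp: sup_absorb1 sup_absorb2)
    then have "inf x y = O' \<or> inf x z = O' \<or> inf y z = O'"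
      using \<open>inf s t = O'\<close> by (auto simp: inf_commute)
    then show False
      using nle O' by auto
  qed
  then have "v' = ?r"
    using \<open>inf s t = O'\<close> \<open>O' \<le> T\<close> st_in le_T
    by (auto simp: v'st inf_absorb1 inf_absorb2 add.commute)
  then show False
    using v'(1) by (simp add: lex_order_def)
qed

theorem theorem2p1:
  assumes "modular_lattice TYPE('a::{finite,lattice})"
  shows "(planar_distributive TYPE('a) \<longleftrightarrow>
            (\<forall>lt :: 'a \<Rightarrow> 'a \<Rightarrow> bool. strict_total_order lt \<longrightarrow>
               squarefree_monomial_ideal
                 (initial_ideal (lex_order lt) (lattice_ideal :: ('a, 'k::field) mpoly set)))) \<and>
         ((\<forall>lt :: 'a \<Rightarrow> 'a \<Rightarrow> bool. strict_total_order lt \<longrightarrow>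
               squarefree_monomial_ideal
                 (initial_ideal (lex_order lt) (lattice_ideal :: ('a, 'k) mpoly set))) \<longleftrightarrow>
            (\<forall>lt :: ('a \<Rightarrow>\<^sub>0 nat) \<Rightarrow> ('a \<Rightarrow>\<^sub>0 nat) \<Rightarrow> bool. monomial_order lt \<longrightarrow>
               squarefree_monomial_ideal
                 (initial_ideal lt (lattice_ideal :: ('a, 'k) mpoly set))))"
    (is "(?planar \<longleftrightarrow> ?lex) \<and> (?lex \<longleftrightarrow> ?all)")
proof -
  have "?all" if "?planar"
    using planar_imp_squarefree_initial_ideal[OF that, where 'k = 'k] by blast
  moreover have "?lex" if "?all"
    using that lex_order_monomial_order by blast
  moreover have "?planar" if lex: "?lex"
  proof -
    have "distributive_lattice TYPE('a)"
      by (rule modular_cancellative_imp_distributive[OF assms])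
        (rule squarefree_lex_imp_cancellative[where 'k = 'k, OF assms], use lex in blast)
    then show ?thesis
      by (rule squarefree_lex_distributive_imp_planar[where 'k = 'k]) (use lex in blast)
  qed
  ultimately show ?thesis
    by blast
qed

end
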